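(* Let $\phi=(c_{ij})_{i,j\in\mathbb{N}}\subset\mathbb{C}$, let $C\ge0$ be a constant and let $1\le q\le p\le+\infty$. The following are equivalent: (i) $\phi$ is a Schur multiplier on $\mathcal{B}(\ell_p,\ell_q)$ with norm $\le C$. (ii) There exist a measure space $(\Omega,\mu)$ (a probability space when $p\ne q$) and two bounded sequences $(x_j)_j$ in $L^p(\mu)$ and $(y_i)_i$ in $L^{q'}(\mu)$ such that $$\forall i,j\in\mathbb{N},\quad c_{ij}=\langle x_j,y_i\rangle\quad\text{and}\quad \sup_i\|y_i\|_{q'}\,\sup_j\|x_j\|_p\le C.$$
   Context: $q'$ is the conjugate exponent of $q$, and $\langle x,y\rangle=\int_\Omega xy\,d\mu$. A matrix $[a_{ij}]_{i,j}$ is regarded as the operator $x\mapsto\left(\sum_j a_{ij}x_j\right)_i$; it is said to be in $\mathcal{B}(\ell_p,\ell_q)$ if this defines a bounded operator $\ell_p\to\ell_q$. A family $(c_{ij})$ of complex numbers is a Schur multiplier on $\mathcal{B}(\ell_p,\ell_q)$ if for every matrix $[a_{ij}]$ in $\mathcal{B}(\ell_p,\ell_q)$ the matrix $[c_{ij}a_{ij}]$ is in $\mathcal{B}(\ell_p,\ell_q)$; its norm is the norm of the (then bounded) map $[a_{ij}]\mapsto[c_{ij}a_{ij}]$ on such matrices with the operator norm. *)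

theory Defs
  imports "HOL-Probability.Probability"
begin

text \<open>
  Exponents range over \<^typ>\<open>ennreal\<close>, so that \<^term>\<open>\<infinity>\<close> is an admissible value, and norms are
  \<^typ>\<open>ennreal\<close>-valued, so that every supremum below is a genuine one.
\<close>

definition Lp_norm :: "'a measure \<Rightarrow> ennreal \<Rightarrow> ('a \<Rightarrow> complex) \<Rightarrow> ennreal" where
  "Lp_norm M p f =
     (if p = \<infinity> then esssup M (\<lambda>w. ennreal (norm (f w)))
      else let I = \<integral>\<^sup>+ w. ennreal (norm (f w) powr enn2real p) \<partial>M
           in if I = \<infinity> then \<infinity> else ennreal (enn2real I powr (1 / enn2real p)))"

definition Lp_space :: "'a measure \<Rightarrow> ennreal \<Rightarrow> ('a \<Rightarrow> complex) set" where
  "Lp_space M p = {f \<in> borel_measurable M. Lp_norm M p f < \<infinity>}"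

text \<open>
  The equation \<open>1/q + 1/q' = 1\<close> solved for \<open>q'\<close>; as \<open>inverse 0 = \<infinity>\<close> and \<open>inverse \<infinity> = 0\<close> in
  \<^typ>\<open>ennreal\<close>, this includes the endpoints.
\<close>

definition conj_exponent :: "ennreal \<Rightarrow> ennreal" where
  "conj_exponent q = inverse (1 - inverse q)"

lemma conj_exponent_1: "conj_exponent 1 = \<infinity>"
  by (simp add: conj_exponent_def)

lemma conj_exponent_infinity: "conj_exponent \<infinity> = 1"
  by (simp add: conj_exponent_def)

text \<open>Bilinear: there is no complex conjugation.\<close>

definition pairing :: "'a measure \<Rightarrow> ('a \<Rightarrow> complex) \<Rightarrow> ('a \<Rightarrow> complex) \<Rightarrow> complex" where
  "pairing M x y = (\<integral>w. x w * y w \<partial>M)"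

abbreviation lp_norm :: "ennreal \<Rightarrow> (nat \<Rightarrow> complex) \<Rightarrow> ennreal" where
  "lp_norm \<equiv> Lp_norm (count_space UNIV)"

abbreviation lp_space :: "ennreal \<Rightarrow> (nat \<Rightarrow> complex) set" where
  "lp_space \<equiv> Lp_space (count_space UNIV)"

type_synonym cmatrix = "nat \<Rightarrow> nat \<Rightarrow> complex"

definition matrix_apply :: "cmatrix \<Rightarrow> (nat \<Rightarrow> complex) \<Rightarrow> nat \<Rightarrow> complex" where
  "matrix_apply a x = (\<lambda>i. \<Sum>j. a i j * x j)"

definition matrix_opnorm :: "ennreal \<Rightarrow> ennreal \<Rightarrow> cmatrix \<Rightarrow> ennreal" where
  "matrix_opnorm p q a = (SUP x\<in>{x. lp_norm p x \<le> 1}. lp_norm q (matrix_apply a x))"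

definition bounded_matrices :: "ennreal \<Rightarrow> ennreal \<Rightarrow> cmatrix set" where
  "bounded_matrices p q =
     {a. (\<forall>x\<in>lp_space p. (\<forall>i. summable (\<lambda>j. a i j * x j)) \<and> matrix_apply a x \<in> lp_space q)
         \<and> matrix_opnorm p q a < \<infinity>}"

definition schur_product :: "cmatrix \<Rightarrow> cmatrix \<Rightarrow> cmatrix" where
  "schur_product c a = (\<lambda>i j. c i j * a i j)"

definition schur_multiplier :: "ennreal \<Rightarrow> ennreal \<Rightarrow> cmatrix \<Rightarrow> bool" where
  "schur_multiplier p q c \<longleftrightarrow>
     (\<forall>a\<in>bounded_matrices p q. schur_product c a \<in> bounded_matrices p q)"

definition schur_norm :: "ennreal \<Rightarrow> ennreal \<Rightarrow> cmatrix \<Rightarrow> ennreal" where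
  "schur_norm p q c =
     (SUP a\<in>{a \<in> bounded_matrices p q. matrix_opnorm p q a \<le> 1}.
        matrix_opnorm p q (schur_product c a))"

text \<open>
  Both suprema are required to be finite because \<open>0 * \<infinity> = 0\<close> in \<^typ>\<open>ennreal\<close>.  The Bochner
  integral in \<^const>\<open>pairing\<close> is total, but for \<open>1 \<le> q \<le> p\<close> it is never used on a
  non-integrable function here: apply Hoelder's inequality, on a probability space if \<open>p \<noteq> q\<close>.

  HOL cannot quantify existentially over the type of points of a measure space.  "There is a measure
  space" is therefore rendered with \<^typ>\<open>real measure\<close> (any underlying set and sigma-algebra) where
  a factorization is produced, and with an arbitrary type of points where one is assumed.
\<close>

definition factorization_on ::
  "'a measure \<Rightarrow> ennreal \<Rightarrow> ennreal \<Rightarrow> cmatrix \<Rightarrow> real \<Rightarrow> bool" where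
  "factorization_on M p q c C \<longleftrightarrow>
     (p \<noteq> q \<longrightarrow> prob_space M) \<and>
     (\<exists>x y :: nat \<Rightarrow> 'a \<Rightarrow> complex.
        (\<forall>j. x j \<in> Lp_space M p) \<and> (SUP j. Lp_norm M p (x j)) < \<infinity> \<and>
        (\<forall>i. y i \<in> Lp_space M (conj_exponent q)) \<and>
        (SUP i. Lp_norm M (conj_exponent q) (y i)) < \<infinity> \<and>
        (\<forall>i j. c i j = pairing M (x j) (y i)) \<and>
        (SUP i. Lp_norm M (conj_exponent q) (y i)) * (SUP j. Lp_norm M p (x j)) \<le> ennreal C)"

end

theory Submission
  imports Defs
begin

text \<open>
  Boundedness of a matrix is tested on finite sections and unit vectors. If a multiplier factors
  through functions \<open>x\<^sub>j\<close>, \<open>y\<^sub>i\<close>, the form of the Schur product at \<open>V\<close>, \<open>U\<close> is the integral of the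
  form of the matrix at \<open>(V\<^sub>j x\<^sub>j)\<close>, \<open>(U\<^sub>i y\<^sub>i)\<close>, and Young's inequality with the three weights
  \<open>1/p\<close>, \<open>1/q'\<close> and \<open>d = 1/q - 1/p\<close> bounds it; the weight \<open>d\<close> multiplies the total mass, whence the
  probability space for \<open>p \<noteq> q\<close>.

  Conversely, testing a multiplier on a suitably rescaled matrix shows that every linear functional
  on the finitely many constraints \<open>c\<^sub>i\<^sub>j = C \<langle>v\<^sub>j, u\<^sub>i\<rangle>\<close>, \<open>\<parallel>v\<^sub>j\<parallel> \<le> 1\<close>, \<open>\<parallel>u\<^sub>i\<parallel> \<le> 1\<close> with \<open>i, j < n\<close> is
  almost nonpositive at some pair of vectors \<open>v\<close>, \<open>u\<close>. A greedy choice of such pairs yields an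
  average over finitely many of them that satisfies the constraints approximately. Homogenising with
  a density \<open>h\<close> keeps all vectors in a fixed product of discs, which is parametrised by one
  real variable; Helly's selection theorem then gives a limit measure on the line.
\<close>

text \<open>The obstacle in the converse is compactness. Averages control only the means of |v_j|^p
  and |u_i|^(q'), so mass may escape to large vectors in a limit of approximate solutions. A pair
  (v, u) of weight one is therefore replaced by (h^(1/p) v, h^(1/q') u) of weight h. As 1/p + 1/q' +
  d = 1, the products of the new entries, completed by h^d, scale by h, and so do the modulars.
  Large vectors become bounded points with small h, and escaped mass becomes mass on h = 0. If d >
  0, the factor h^d makes that mass invisible, and weighting by h yields a probability measure. If d
  = 0, it still contributes to the pairings, so the limit measure is kept up to a scalar; this is
  why p = q comes without a normalised measure. The greedy choice takes the place of a separation
  theorem. It asks the functionals to be at most 1, not at most 0, which tolerates suprema that are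
  not attained.\<close>

section \<open>Exponents and norms\<close>

text \<open>
  The exponent \<open>\<infinity>\<close> is represented by the real number 0, in accordance with \<open>enn2real \<infinity> = 0\<close>. As
  \<open>1 / 0 = 0\<close>, the relations between reciprocal exponents then hold without exception.
\<close>

definition modular :: "real \<Rightarrow> real \<Rightarrow> real" where
  "modular P t = (if P = 0 then 0 else t powr P)"

definition admissible :: "real \<Rightarrow> bool" where
  "admissible P \<longleftrightarrow> P = 0 \<or> 1 \<le> P"

definition unit_seq :: "real \<Rightarrow> nat \<Rightarrow> (nat \<Rightarrow> complex) \<Rightarrow> bool" where
  "unit_seq P n V \<longleftrightarrow>
     (if P = 0 then \<forall>j<n. cmod (V j) \<le> 1 else (\<Sum>j<n. cmod (V j) powr P) \<le> 1)"

lemma modular_nonneg: "0 \<le> modular P t"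
  by (simp add: modular_def)

lemma admissible_inverse: "admissible P \<Longrightarrow> 0 \<le> 1 / P"
  by (auto simp: admissible_def)

text \<open>Convexity of \<open>exp\<close>: for \<open>t = exp (a/P)\<close> and
  \<open>s = exp (b/R)\<close> this is Jensen's inequality at the points a, b, 0 with the weights
  1/P, 1/R, d. The tangent at their mean \<open>m\<close> lies below \<open>exp\<close> at all three
  points.\<close>

lemma Young_three:
  assumes "admissible P" "admissible R" "0 \<le> t" "0 \<le> s"
    and t1: "P = 0 \<longrightarrow> t \<le> 1" and s1: "R = 0 \<longrightarrow> s \<le> 1" and d: "d = 1 - 1/P - 1/R" "0 \<le> d"
  shows "t * s \<le> 1/P * modular P t + 1/R * modular R s + d"
proof (cases "t = 0 \<or> s = 0")
  case True
  then show ?thesis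
    using assms admissible_inverse[of P] admissible_inverse[of R]
      mult_nonneg_nonneg[OF admissible_inverse[of P] modular_nonneg[of P t]]
      mult_nonneg_nonneg[OF admissible_inverse[of R] modular_nonneg[of R s]] by auto
next
  case False
  then have pos: "t > 0" "s > 0" using assms by auto
  define a where "a = P * ln t"
  define b where "b = R * ln s"
  define m where "m = 1/P * a + 1/R * b"
  \<comment> \<open>An equality unless P = 0; then the right side is 0 and \<open>t \<le> 1\<close>
    is used.\<close>
  have ra: "ln t \<le> 1/P * a" using t1 pos by (auto simp: a_def)
  have sb: "ln s \<le> 1/R * b" using s1 pos by (auto simp: b_def)
  have ea: "1/P * modular P t = 1/P * exp a"
    using pos by (simp add: modular_def a_def powr_def)
  have eb: "1/R * modular R s = 1/R * exp b"
    using pos by (simp add: modular_def b_def powr_def)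
  have tangent: "exp m * (1 + x - m) \<le> exp x" for x
  proof -
    have "exp m * (1 + (x - m)) \<le> exp m * exp (x - m)"
      by (intro mult_left_mono exp_ge_add_one_self) auto
    then show ?thesis by (simp add: exp_diff algebra_simps)
  qed
  have "t * s = exp (ln t + ln s)" using pos by (simp add: exp_add)
  also have "\<dots> \<le> exp m" using ra sb by (simp add: m_def)
  also have "\<dots> = 1/P * (exp m * (1 + a - m)) + 1/R * (exp m * (1 + b - m)) + d * (exp m * (1 + 0 - m))"
  proof -
    have "1/P * (exp m * (1 + a - m)) + 1/R * (exp m * (1 + b - m)) + d * (exp m * (1 + 0 - m))
      = exp m * ((1/P + 1/R + d) * (1 - m) + (1/P * a + 1/R * b))"
      by (simp add: algebra_simps add_divide_distrib diff_divide_distrib)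
    also have "1/P + 1/R + d = 1" using d by simp
    finally show ?thesis unfolding m_def by simp
  qed
  also have "\<dots> \<le> 1/P * exp a + 1/R * exp b + d * exp 0"
    using assms by (intro add_mono mult_left_mono tangent admissible_inverse) auto
  finally show ?thesis unfolding ea eb by simp
qed

lemma ennreal_exponent_cases:
  assumes "1 \<le> (p::ennreal)"
  obtains (infinite) "p = \<infinity>" "enn2real p = 0" | (finite) "p \<noteq> \<infinity>" "1 \<le> enn2real p" "p = ennreal (enn2real p)"
proof (cases p)
  case (real r)
  then have "1 \<le> r" using assms by (metis ennreal_1 ennreal_le_iff)
  then show ?thesis using finite real by auto
next
  case top
  then show ?thesis using infinite by simp
qed

lemma admissible_enn2real: "1 \<le> p \<Longrightarrow> admissible (enn2real p)"
  by (erule ennreal_exponent_cases) (auto simp: admissible_def)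

lemma enn2real_eq_0_iff_infinite: "1 \<le> p \<Longrightarrow> enn2real p = 0 \<longleftrightarrow> p = \<infinity>"
  by (erule ennreal_exponent_cases) auto

lemma conj_exponent:
  assumes "1 \<le> q"
  shows one_le_conj_exponent: "1 \<le> conj_exponent q"
    and inverse_conj_exponent: "1 / enn2real q + 1 / enn2real (conj_exponent q) = 1"
proof -
  have "1 \<le> conj_exponent q \<and> 1 / enn2real q + 1 / enn2real (conj_exponent q) = 1"
    using assms
  proof (cases rule: ennreal_exponent_cases)
    case infinite
    then show ?thesis by (simp add: conj_exponent_infinity flip: infinity_ennreal_def)
  next
    case finite
    show ?thesis
    proof (cases "q = 1")
      case True
      then show ?thesis using conj_exponent_1 by simp
    next
      case False
      define x where "x = enn2real q"
      have qx: "q = ennreal x" and x: "x > 1" using finite False by (auto simp: x_def less_le)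
      have "1 - inverse q = ennreal (1 - 1/x)"
        using x by (simp add: qx inverse_ennreal ennreal_minus[symmetric] inverse_eq_divide)
      then have "conj_exponent q = ennreal (x / (x - 1))"
        using x by (simp add: conj_exponent_def inverse_ennreal field_simps)
      moreover have "1 \<le> ennreal (x / (x - 1))"
        using x by (simp add: field_simps flip: ennreal_1)
      ultimately show ?thesis using x by (simp add: qx field_simps)
    qed
  qed
  then show "1 \<le> conj_exponent q" "1 / enn2real q + 1 / enn2real (conj_exponent q) = 1" by auto
qed

lemma Lp_norm_le_1_iff:
  assumes "1 \<le> p" "f \<in> borel_measurable M"
  shows "Lp_norm M p f \<le> 1 \<longleftrightarrow>
    (if p = \<infinity> then AE w in M. cmod (f w) \<le> 1
     else (\<integral>\<^sup>+ w. ennreal (cmod (f w) powr enn2real p) \<partial>M) \<le> 1)"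
  using assms(1)
proof (cases rule: ennreal_exponent_cases)
  case infinite
  have "esssup M (\<lambda>w. ennreal (cmod (f w))) \<le> 1 \<longleftrightarrow> (AE w in M. ennreal (cmod (f w)) \<le> 1)"
  proof
    assume le: "esssup M (\<lambda>w. ennreal (cmod (f w))) \<le> 1"
    show "AE w in M. ennreal (cmod (f w)) \<le> 1"
      using esssup_AE[of "\<lambda>w. ennreal (cmod (f w))" M] by eventually_elim (use le order_trans in blast)
  qed (use assms in \<open>auto intro!: esssup_I\<close>)
  then show ?thesis using infinite by (simp add: Lp_norm_def)
next
  case finite
  define I where "I = (\<integral>\<^sup>+ w. ennreal (cmod (f w) powr enn2real p) \<partial>M)"
  show ?thesis
  proof (cases I)
    case (real i)
    have "i powr (1 / enn2real p) \<le> 1 \<longleftrightarrow> i \<le> 1"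
    proof (cases "i \<le> 1")
      case True
      then show ?thesis using real finite powr_le1[of "1 / enn2real p" i] by simp
    next
      case False
      then have "1 < i powr (1 / enn2real p)" using finite by (intro gr_one_powr) auto
      then show ?thesis using False by simp
    qed
    then show ?thesis using finite real unfolding Lp_norm_def by (simp add: I_def[symmetric])
  next
    case top
    then show ?thesis using finite by (simp add: Lp_norm_def I_def[symmetric] top_unique)
  qed
qed

lemma Lp_norm_scale_le:
  assumes "1 \<le> p" "f \<in> borel_measurable M" "c \<noteq> 0"
  shows "Lp_norm M p (\<lambda>w. c * f w) \<le> ennreal (cmod c) * Lp_norm M p f"
  using assms(1)
proof (cases rule: ennreal_exponent_cases)
  case infinite
  have "AE w in M. ennreal (cmod (c * f w)) \<le> ennreal (cmod c) * esssup M (\<lambda>w. ennreal (cmod (f w)))"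
    using esssup_AE[of "\<lambda>w. ennreal (cmod (f w))" M]
    by eventually_elim (auto simp: norm_mult ennreal_mult intro!: mult_left_mono)
  then show ?thesis using infinite assms by (auto simp: Lp_norm_def intro!: esssup_I)
next
  case finite
  define P where "P = enn2real p"
  have P: "1 \<le> P" using finite by (simp add: P_def)
  define I where "I = (\<integral>\<^sup>+ w. ennreal (cmod (f w) powr P) \<partial>M)"
  have scale: "(\<integral>\<^sup>+ w. ennreal (cmod (c * f w) powr P) \<partial>M) = ennreal (cmod c powr P) * I"
    unfolding I_def using assms(2)
    by (subst nn_integral_cmult[symmetric]) (auto simp: norm_mult powr_mult ennreal_mult)
  show ?thesis
  proof (cases I)
    case (real i)
    then show ?thesis using finite P
      unfolding Lp_norm_def P_def[symmetric] scale
      by (simp add: P_def[symmetric] I_def[symmetric] ennreal_mult[symmetric] powr_mult powr_powr ennreal_mult_eq_top_iff enn2real_mult)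
  next
    case top
    then show ?thesis using finite assms(3)
      by (simp add: Lp_norm_def P_def[symmetric] I_def[symmetric] ennreal_mult_top)
  qed
qed

text \<open>Reduces a norm bound to the unit ball, where \<open>Lp_norm_le_1_iff\<close> involves no
  root. The scaling inequality is used once with 1/B and once with B.\<close>

lemma Lp_norm_le_iff:
  assumes "1 \<le> p" "f \<in> borel_measurable M" "0 < B"
  shows "Lp_norm M p f \<le> ennreal B \<longleftrightarrow> Lp_norm M p (\<lambda>w. complex_of_real (1/B) * f w) \<le> 1"
proof
  assume "Lp_norm M p f \<le> ennreal B"
  then have "ennreal (1/B) * Lp_norm M p f \<le> ennreal (1/B) * ennreal B"
    by (intro mult_left_mono) auto
  also have "\<dots> = 1" using assms(3) by (simp add: ennreal_mult[symmetric])
  finally show "Lp_norm M p (\<lambda>w. complex_of_real (1/B) * f w) \<le> 1"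
    using Lp_norm_scale_le[OF assms(1,2), of "complex_of_real (1/B)"] assms(3)
    by (auto simp: norm_divide intro: order_trans)
next
  assume *: "Lp_norm M p (\<lambda>w. complex_of_real (1/B) * f w) \<le> 1"
  have "Lp_norm M p f = Lp_norm M p (\<lambda>w. complex_of_real B * (complex_of_real (1/B) * f w))"
    using assms(3) by simp
  also have "\<dots> \<le> ennreal (cmod (complex_of_real B)) * Lp_norm M p (\<lambda>w. complex_of_real (1/B) * f w)"
    using assms by (intro Lp_norm_scale_le) auto
  also have "\<dots> \<le> ennreal B * 1" using * assms(3) by (intro mult_mono) auto
  finally show "Lp_norm M p f \<le> ennreal B" by simp
qed

text \<open>Supplies what Young's inequality consumes: an integral bound for a finite exponent, a
  pointwise bound for the infinite one, whose modular is 0 by definition.\<close>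

lemma Lp_norm_le_1_modular:
  assumes p: "1 \<le> p" and f: "f \<in> borel_measurable M" and le: "Lp_norm M p f \<le> 1"
  defines "P \<equiv> enn2real p"
  shows "integrable M (\<lambda>w. modular P (cmod (f w)))"
    and "(\<integral>w. modular P (cmod (f w)) \<partial>M) \<le> 1"
    and "P = 0 \<Longrightarrow> AE w in M. cmod (f w) \<le> 1"
proof -
  have P0: "P = 0 \<longleftrightarrow> p = \<infinity>" using enn2real_eq_0_iff_infinite[OF p] by (simp add: P_def)
  show "P = 0 \<Longrightarrow> AE w in M. cmod (f w) \<le> 1"
    using le P0 unfolding Lp_norm_le_1_iff[OF p f] by simp
  have "integrable M (\<lambda>w. modular P (cmod (f w))) \<and> (\<integral>w. modular P (cmod (f w)) \<partial>M) \<le> 1"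
  proof (cases "P = 0")
    case True
    then show ?thesis by (simp add: modular_def)
  next
    case False
    then have I: "(\<integral>\<^sup>+ w. ennreal (cmod (f w) powr P) \<partial>M) \<le> 1"
      using le P0 Lp_norm_le_1_iff[OF p f] by (simp add: P_def)
    have "integrable M (\<lambda>w. cmod (f w) powr P)"
      using f le_less_trans[OF I] by (intro integrableI_nonneg) auto
    moreover from this have "ennreal (\<integral>w. cmod (f w) powr P \<partial>M) \<le> 1"
      using I by (subst nn_integral_eq_integral[symmetric]) auto
    then have "(\<integral>w. cmod (f w) powr P \<partial>M) \<le> 1" by simp
    ultimately show ?thesis using False by (simp add: modular_def)
  qed
  then show "integrable M (\<lambda>w. modular P (cmod (f w)))" "(\<integral>w. modular P (cmod (f w)) \<partial>M) \<le> 1"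
    by auto
qed

lemma lp_norm_le_1_iff:
  assumes "1 \<le> p"
  shows "lp_norm p V \<le> 1 \<longleftrightarrow> (\<forall>n. unit_seq (enn2real p) n V)"
  using assms
proof (cases rule: ennreal_exponent_cases)
  case infinite
  then show ?thesis
    by (subst Lp_norm_le_1_iff[OF assms]) (auto simp: unit_seq_def AE_count_space)
next
  case finite
  define P where "P = enn2real p"
  have "(\<Sum>j. ennreal (cmod (V j) powr P)) \<le> 1 \<longleftrightarrow> (\<forall>n. (\<Sum>j<n. ennreal (cmod (V j) powr P)) \<le> 1)"
    by (simp add: suminf_eq_SUP SUP_le_iff)
  also have "\<dots> \<longleftrightarrow> (\<forall>n. (\<Sum>j<n. cmod (V j) powr P) \<le> 1)"
    by (simp add: sum_nonneg)
  finally show ?thesis using finite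
    by (subst Lp_norm_le_1_iff[OF assms]) (auto simp: unit_seq_def nn_integral_count_space_nat P_def)
qed

section \<open>Duality and finite sections of matrices\<close>

lemma modular_sum_unit_seq: "unit_seq P n V \<Longrightarrow> (\<Sum>j<n. modular P (cmod (V j))) \<le> 1"
  by (auto simp: unit_seq_def modular_def split: if_splits)

lemma unit_seq_le_1:
  assumes "admissible P" "unit_seq P n V" "j < n"
  shows "cmod (V j) \<le> 1"
proof (cases "P = 0")
  case False
  then have P: "1 \<le> P" using assms by (auto simp: admissible_def)
  have "cmod (V j) powr P \<le> (\<Sum>j<n. cmod (V j) powr P)"
    using assms by (intro member_le_sum) auto
  also have "\<dots> \<le> 1" using assms False by (simp add: unit_seq_def)
  finally show ?thesis using P gr_one_powr[of "cmod (V j)" P] by fastforce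
qed (use assms in \<open>auto simp: unit_seq_def\<close>)

lemma unit_seq_cong:
  "(\<And>j. j < n \<Longrightarrow> cmod (V j) = cmod (W j)) \<Longrightarrow> unit_seq P n V \<longleftrightarrow> unit_seq P n W"
  by (auto simp: unit_seq_def)

lemma unit_seq_truncate:
  assumes "unit_seq P n V"
  shows "unit_seq P m (\<lambda>j. if j < n then V j else 0)"
proof (cases "P = 0")
  case True
  then show ?thesis using assms by (auto simp: unit_seq_def)
next
  case False
  have "(\<Sum>j<m. cmod (if j < n then V j else 0) powr P) = (\<Sum>j\<in>{..<m} \<inter> {..<n}. cmod (V j) powr P)"
    using False by (subst sum.inter_restrict) (auto intro!: sum.cong)
  also have "\<dots> \<le> (\<Sum>j<n. cmod (V j) powr P)" by (intro sum_mono2) auto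
  also have "\<dots> \<le> 1" using assms False by (simp add: unit_seq_def)
  finally show ?thesis using False by (simp add: unit_seq_def)
qed

lemma unit_seq_single: "unit_seq P n (\<lambda>j. if j = i then 1 else 0)"
proof -
  have "(\<Sum>j<n. cmod (if j = i then 1 else 0) powr P) = (\<Sum>j<n. if j = i then 1 else 0)"
    by (intro sum.cong) auto
  then show ?thesis by (auto simp: unit_seq_def)
qed

text \<open>The case \<open>d = 0\<close> of \<open>Young_three\<close>, summed over the
  section.\<close>

lemma Hoelder_unit_seq:
  assumes "admissible Q" "admissible R" "1/Q + 1/R = 1" "unit_seq Q n w" "unit_seq R n U"
  shows "cmod (\<Sum>i<n. w i * U i) \<le> 1"
proof -
  have "cmod (\<Sum>i<n. w i * U i) \<le> (\<Sum>i<n. cmod (w i) * cmod (U i))"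
    by (intro order_trans[OF norm_sum]) (simp add: norm_mult)
  also have "\<dots> \<le> (\<Sum>i<n. 1/Q * modular Q (cmod (w i)) + 1/R * modular R (cmod (U i)) + 0)"
    using assms by (intro sum_mono Young_three) (auto intro: unit_seq_le_1)
  also have "\<dots> = 1/Q * (\<Sum>i<n. modular Q (cmod (w i))) + 1/R * (\<Sum>i<n. modular R (cmod (U i)))"
    by (simp add: sum.distrib sum_distrib_left sum_divide_distrib)
  also have "\<dots> \<le> 1/Q * 1 + 1/R * 1"
    using assms by (intro add_mono mult_left_mono modular_sum_unit_seq admissible_inverse) auto
  finally show ?thesis using assms by simp
qed

lemma mult_cnj_sgn: "z * cnj (sgn z) = complex_of_real (cmod z)"
proof (cases "z = 0")
  case False
  have "z * cnj (sgn z) = z * cnj z / complex_of_real (cmod z)" by (simp add: sgn_eq)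
  also have "\<dots> = complex_of_real (cmod z)"
    unfolding complex_norm_square[symmetric] using False by (simp add: power2_eq_square)
  finally show ?thesis .
qed simp

text \<open>The extremal \<open>U\<close> is \<open>cnj (sgn w) \<bar>w\<bar> powr (Q - 1)\<close>, normalised.\<close>

lemma unit_seq_dual:
  assumes "admissible Q" "admissible R" "1/Q + 1/R = 1"
    and le: "\<And>U. unit_seq R n U \<Longrightarrow> cmod (\<Sum>i<n. w i * U i) \<le> 1"
  shows "unit_seq Q n w"
proof (cases "Q = 0")
  case True
  have "cmod (w i) \<le> 1" if "i < n" for i
    using le[OF unit_seq_single[of R n i]] that by (simp add: if_distrib cong: if_cong)
  then show ?thesis using True by (simp add: unit_seq_def)
next
  case False
  then have Q: "1 \<le> Q" using assms by (auto simp: admissible_def)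
  define N where "N = (\<Sum>i<n. cmod (w i) powr Q)"
  have N0: "N \<ge> 0" by (simp add: N_def sum_nonneg)
  show ?thesis
  proof (cases "N = 0")
    case True
    then show ?thesis using False by (simp add: unit_seq_def N_def)
  next
    case N: False
    define U where "U i = cnj (sgn (w i)) * complex_of_real (cmod (w i) powr (Q - 1) / N powr (1/R))" for i
    have cU: "cmod (U i) = (if w i = 0 then 0 else cmod (w i) powr (Q - 1) / N powr (1/R))" for i
      using N0 by (simp add: U_def norm_mult norm_sgn norm_divide)
    have "unit_seq R n U"
    proof (cases "R = 0")
      case True
      then have "Q = 1" using assms by auto
      then show ?thesis using True N N0 by (auto simp: unit_seq_def cU)
    next
      case R: False
      have QR: "(Q - 1) * R = Q" using assms(3) R False by (simp add: field_simps)
      have "(\<Sum>i<n. cmod (U i) powr R) = (\<Sum>i<n. cmod (w i) powr Q / N)"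
        using N N0 R Q by (intro sum.cong) (auto simp: cU powr_divide powr_powr QR)
      also have "\<dots> = 1" using N by (simp add: N_def sum_divide_distrib[symmetric])
      finally show ?thesis using R by (simp add: unit_seq_def)
    qed
    from le[OF this] have "cmod (\<Sum>i<n. w i * U i) \<le> 1" .
    moreover have "(\<Sum>i<n. w i * U i) = complex_of_real (N / N powr (1/R))"
    proof -
      have "w i * U i = complex_of_real (cmod (w i) powr Q / N powr (1/R))" for i
      proof (cases "w i = 0")
        case w: False
        have "w i * cnj (sgn (w i)) = complex_of_real (cmod (w i))"
          by (rule mult_cnj_sgn)
        moreover have "cmod (w i) * cmod (w i) powr (Q - 1) = cmod (w i) powr Q"
          using w by (simp add: powr_diff)
        ultimately show ?thesis unfolding U_def
          by (metis (no_types, lifting) mult.assoc of_real_mult times_divide_eq_right)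
      qed (simp add: U_def)
      then show ?thesis by (simp add: N_def sum_divide_distrib)
    qed
    ultimately have "N / N powr (1/R) \<le> 1" using N0 by (simp add: norm_divide)
    also have "N / N powr (1/R) = N powr (1/Q)"
    proof -
      have "1/Q = 1 - 1/R" using assms(3) by simp
      then show ?thesis using N N0 by (simp add: powr_diff)
    qed
    finally have "N \<le> 1" using N0 Q gr_one_powr[of N "1/Q"] by fastforce
    then show ?thesis using False by (simp add: unit_seq_def N_def)
  qed
qed

text \<open>Duality is applied section by section, so that it is only used in finite
  dimension.\<close>

lemma lp_norm_le_iff_pairing:
  assumes q: "1 \<le> q" and K: "0 \<le> K"
  shows "lp_norm q w \<le> ennreal K \<longleftrightarrow>
    (\<forall>n U. unit_seq (enn2real (conj_exponent q)) n U \<longrightarrow> cmod (\<Sum>i<n. w i * U i) \<le> K)"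
proof -
  define Q where "Q = enn2real q"
  define R where "R = enn2real (conj_exponent q)"
  have adm: "admissible Q" "admissible R" and QR: "1/Q + 1/R = 1"
    using conj_exponent[OF q] q by (auto simp: Q_def R_def intro: admissible_enn2real)
  have pos: "lp_norm q w \<le> ennreal B \<longleftrightarrow>
      (\<forall>n U. unit_seq R n U \<longrightarrow> cmod (\<Sum>i<n. w i * U i) \<le> B)" if B: "0 < B" for B
  proof -
    have *: "cmod (\<Sum>i<n. complex_of_real (1/B) * w i * U i) = cmod (\<Sum>i<n. w i * U i) / B" for n U
    proof -
      have "(\<Sum>i<n. complex_of_real (1/B) * w i * U i) = complex_of_real (1/B) * (\<Sum>i<n. w i * U i)"
        by (simp add: sum_distrib_left mult.assoc)
      then show ?thesis using B by (simp add: norm_divide)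
    qed
    have "lp_norm q w \<le> ennreal B \<longleftrightarrow> (\<forall>n. unit_seq Q n (\<lambda>i. complex_of_real (1/B) * w i))"
      using lp_norm_le_1_iff[OF q] Lp_norm_le_iff[OF q _ B, of w "count_space UNIV"] by (simp add: Q_def)
    also have "\<dots> \<longleftrightarrow> (\<forall>n U. unit_seq R n U \<longrightarrow> cmod (\<Sum>i<n. complex_of_real (1/B) * w i * U i) \<le> 1)"
    proof (intro all_cong1 iffI allI impI)
      show "cmod (\<Sum>i<n. complex_of_real (1/B) * w i * U i) \<le> 1"
        if "unit_seq Q n (\<lambda>i. complex_of_real (1/B) * w i)" "unit_seq R n U" for n U
        by (rule Hoelder_unit_seq[OF adm QR that])
    next
      show "unit_seq Q n (\<lambda>i. complex_of_real (1/B) * w i)"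
        if "\<forall>U. unit_seq R n U \<longrightarrow> cmod (\<Sum>i<n. complex_of_real (1/B) * w i * U i) \<le> 1" for n
        by (rule unit_seq_dual[OF adm QR]) (use that in blast)
    qed
    finally show ?thesis unfolding * using B by (simp add: divide_le_eq)
  qed
  \<comment> \<open>K = 0 cannot be rescaled to 1, so both directions approach K from above.\<close>
  show ?thesis unfolding R_def[symmetric]
  proof
    assume "lp_norm q w \<le> ennreal K"
    then have "lp_norm q w \<le> ennreal B" if "K < B" for B
      using that by (meson ennreal_leI less_imp_le order_trans)
    then have le: "cmod (\<Sum>i<n. w i * U i) \<le> B" if "K < B" "unit_seq R n U" for B n U
      using pos[of B] that K by simp
    show "\<forall>n U. unit_seq R n U \<longrightarrow> cmod (\<Sum>i<n. w i * U i) \<le> K"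
      using dense_ge[OF le] by blast
  next
    assume "\<forall>n U. unit_seq R n U \<longrightarrow> cmod (\<Sum>i<n. w i * U i) \<le> K"
    then have le: "lp_norm q w \<le> ennreal B" if "K < B" for B
      using pos[of B] that K by (meson le_less_trans less_imp_le order_trans)
    show "lp_norm q w \<le> ennreal K"
    proof (rule ennreal_le_epsilon)
      fix e :: real assume "0 < e"
      then show "lp_norm q w \<le> ennreal K + ennreal e" using le[of "K + e"] K by simp
    qed
  qed
qed

section \<open>Bilinear forms of finite sections\<close>

definition bil :: "nat \<Rightarrow> cmatrix \<Rightarrow> (nat \<Rightarrow> complex) \<Rightarrow> (nat \<Rightarrow> complex) \<Rightarrow> complex" where
  "bil n a V U = (\<Sum>i<n. \<Sum>j<n. a i j * V j * U i)"

definition form_bound :: "real \<Rightarrow> real \<Rightarrow> cmatrix \<Rightarrow> real \<Rightarrow> bool" where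
  "form_bound P R a K \<longleftrightarrow>
     (\<forall>n V U. unit_seq P n V \<longrightarrow> unit_seq R n U \<longrightarrow> cmod (bil n a V U) \<le> K)"

lemma bil_cong:
  "(\<And>j. j < n \<Longrightarrow> V j = V' j) \<Longrightarrow> (\<And>j. j < n \<Longrightarrow> U j = U' j) \<Longrightarrow> bil n a V U = bil n a V' U'"
  by (simp add: bil_def)

lemma bil_scale: "bil n a (\<lambda>j. s * V j) (\<lambda>i. t * U i) = s * t * bil n a V U"
  by (simp add: bil_def sum_distrib_left mult_ac)

lemma opnorm_le_form_bound:
  assumes p: "1 \<le> p" and q: "1 \<le> q" and K: "0 \<le> K"
    and a: "a \<in> bounded_matrices p q" "matrix_opnorm p q a \<le> ennreal K"
  shows "form_bound (enn2real p) (enn2real (conj_exponent q)) a K"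
  unfolding form_bound_def
proof (intro allI impI)
  fix n V U
  assume V: "unit_seq (enn2real p) n V" and U: "unit_seq (enn2real (conj_exponent q)) n U"
  define V' where "V' = (\<lambda>j. if j < n then V j else 0)"
  have "lp_norm p V' \<le> 1"
    using unit_seq_truncate[OF V] by (simp add: lp_norm_le_1_iff[OF p] V'_def)
  then have "lp_norm q (matrix_apply a V') \<le> matrix_opnorm p q a"
    unfolding matrix_opnorm_def by (intro SUP_upper) simp
  also note a(2)
  finally have "cmod (\<Sum>i<n. matrix_apply a V' i * U i) \<le> K"
    using lp_norm_le_iff_pairing[OF q K] U by blast
  also have "(\<Sum>i<n. matrix_apply a V' i * U i) = bil n a V U"
  proof -
    have "matrix_apply a V' i = (\<Sum>j<n. a i j * V j)" for i
      unfolding matrix_apply_def by (subst suminf_finite[of "{..<n}"]) (auto simp: V'_def)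
    then show ?thesis by (simp add: bil_def sum_distrib_right)
  qed
  finally show "cmod (bil n a V U) \<le> K" .
qed

text \<open>The phases of V can be aligned with row i without leaving the unit ball, and the second
  argument is the i-th unit vector. This yields the summability demanded in
  \<open>bounded_matrices\<close>.\<close>

lemma form_bound_row:
  assumes a: "form_bound P R a K" and R: "admissible R" and V: "unit_seq P n V" and "i < n"
  shows "(\<Sum>j<n. cmod (a i j * V j)) \<le> K"
proof -
  define W where "W j = V j * (if a i j * V j = 0 then 1 else cnj (sgn (a i j * V j)))" for j
  have W: "unit_seq P n W"
    using V unit_seq_cong[of n W V P] by (simp add: W_def norm_mult norm_sgn)
  have "bil n a W (\<lambda>k. if k = i then 1 else 0) = (\<Sum>j<n. a i j * W j)"
  proof -
    have "bil n a W (\<lambda>k. if k = i then 1 else 0) = (\<Sum>k<n. if k = i then \<Sum>j<n. a k j * W j else 0)"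
      unfolding bil_def by (intro sum.cong) auto
    then show ?thesis using \<open>i < n\<close> by simp
  qed
  also have "\<dots> = complex_of_real (\<Sum>j<n. cmod (a i j * V j))"
  proof -
    have "a i j * W j = complex_of_real (cmod (a i j * V j))" for j
    proof (cases "a i j * V j = 0")
      case False
      have "a i j * W j = (a i j * V j) * cnj (sgn (a i j * V j))" using False by (simp add: W_def)
      also have "\<dots> = complex_of_real (cmod (a i j * V j))"
        by (rule mult_cnj_sgn)
      finally show ?thesis .
    qed (auto simp: W_def)
    then show ?thesis by simp
  qed
  finally have "cmod (complex_of_real (\<Sum>j<n. cmod (a i j * V j))) \<le> K"
    using a W unit_seq_single[of R n i] unfolding form_bound_def by metis
  then show ?thesis by (simp add: sum_nonneg del: of_real_sum)
qed

lemma Lp_space_normalise: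
  assumes "1 \<le> p" "f \<in> Lp_space M p"
  obtains B where "0 < B" "Lp_norm M p (\<lambda>w. complex_of_real (1/B) * f w) \<le> 1"
proof -
  have fin: "Lp_norm M p f < \<infinity>" and f: "f \<in> borel_measurable M" using assms by (auto simp: Lp_space_def)
  \<comment> \<open>The summand 1 keeps \<open>B\<close> positive when the norm is 0.\<close>
  define B where "B = enn2real (Lp_norm M p f) + 1"
  have B: "0 < B" by (simp add: B_def add_nonneg_pos)
  have "Lp_norm M p f = ennreal (enn2real (Lp_norm M p f))" using fin by simp
  also have "\<dots> \<le> ennreal B" by (intro ennreal_leI) (simp add: B_def)
  finally show ?thesis using that B Lp_norm_le_iff[OF assms(1) f B] by blast
qed

lemma form_bound_imp_bounded:
  assumes p: "1 \<le> p" and q: "1 \<le> q" and K: "0 \<le> K"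
    and a: "form_bound (enn2real p) (enn2real (conj_exponent q)) a K"
  shows "a \<in> bounded_matrices p q \<and> matrix_opnorm p q a \<le> ennreal K"
proof -
  define P where "P = enn2real p"
  define R where "R = enn2real (conj_exponent q)"
  have R: "admissible R" using one_le_conj_exponent[OF q] by (simp add: R_def admissible_enn2real)
  have ball: "(\<forall>i. summable (\<lambda>j. a i j * V j)) \<and> lp_norm q (matrix_apply a V) \<le> ennreal K"
    if V: "lp_norm p V \<le> 1" for V
  proof -
    have Vn: "unit_seq P n V" for n using V lp_norm_le_1_iff[OF p] by (simp add: P_def)
    have summ: "summable (\<lambda>j. a i j * V j)" for i
    proof (rule summable_norm_cancel, rule summableI_nonneg_bounded)
      fix n
      \<comment> \<open>Row i has to lie inside the section, hence
        \<open>max n (Suc i)\<close>.\<close>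
      have "(\<Sum>j<n. norm (a i j * V j)) \<le> (\<Sum>j<max n (Suc i). norm (a i j * V j))"
        by (intro sum_mono2) auto
      also have "\<dots> \<le> K" using form_bound_row[OF a[folded P_def R_def] R Vn] by simp
      finally show "(\<Sum>j<n. norm (a i j * V j)) \<le> K" .
    qed auto
    have "cmod (\<Sum>i<n. matrix_apply a V i * U i) \<le> K" if U: "unit_seq R n U" for n U
    proof (rule LIMSEQ_le_const2)
      show "(\<lambda>m. cmod (\<Sum>i<n. (\<Sum>j<m. a i j * V j) * U i))
          \<longlonglongrightarrow> cmod (\<Sum>i<n. matrix_apply a V i * U i)"
        unfolding matrix_apply_def by (intro tendsto_intros summable_LIMSEQ summ)
      \<comment> \<open>Padding U by zeros turns the n by m section into a square one.\<close>
      have "cmod (\<Sum>i<n. (\<Sum>j<m. a i j * V j) * U i) \<le> K" if "n \<le> m" for m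
      proof -
        define U' where "U' = (\<lambda>i. if i < n then U i else 0)"
        have "(\<Sum>i<n. (\<Sum>j<m. a i j * V j) * U i) = (\<Sum>i<m. (\<Sum>j<m. a i j * V j) * U' i)"
          using that by (intro sum.mono_neutral_cong_left) (auto simp: U'_def)
        also have "\<dots> = bil m a V U'" by (simp add: bil_def sum_distrib_right)
        also have "cmod \<dots> \<le> K"
          using a Vn unit_seq_truncate[OF U, of m] by (auto simp: form_bound_def P_def R_def U'_def)
        finally show ?thesis .
      qed
      then show "\<exists>N. \<forall>m\<ge>N. cmod (\<Sum>i<n. (\<Sum>j<m. a i j * V j) * U i) \<le> K" by blast
    qed
    then show ?thesis using lp_norm_le_iff_pairing[OF q K] summ by (simp add: R_def)
  qed
  have op: "matrix_opnorm p q a \<le> ennreal K"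
    unfolding matrix_opnorm_def using ball by (intro SUP_least) auto
  moreover have "(\<forall>i. summable (\<lambda>j. a i j * V j)) \<and> matrix_apply a V \<in> lp_space q"
    if V: "V \<in> lp_space p" for V
  proof -
    obtain B where B: "0 < B" "lp_norm p (\<lambda>w. complex_of_real (1/B) * V w) \<le> 1"
      using Lp_space_normalise[OF p V] by blast
    define W where "W j = complex_of_real (1/B) * V j" for j
    have W: "\<And>i. summable (\<lambda>j. a i j * W j)" "lp_norm q (matrix_apply a W) \<le> ennreal K"
      using ball[of W] B(2) unfolding W_def[symmetric] by auto
    have VW: "V = (\<lambda>j. complex_of_real B * W j)" using B by (auto simp: W_def)
    have s: "summable (\<lambda>j. a i j * V j)" for i
      using summable_mult[OF W(1)[of i], of "complex_of_real B"] by (simp add: VW mult_ac)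
    have "matrix_apply a V = (\<lambda>i. complex_of_real B * matrix_apply a W i)"
      unfolding matrix_apply_def using suminf_mult[OF W(1), of "complex_of_real B"] by (simp add: VW mult_ac)
    then have "lp_norm q (matrix_apply a V) \<le> ennreal (cmod (complex_of_real B)) * lp_norm q (matrix_apply a W)"
      using Lp_norm_scale_le[OF q, of "matrix_apply a W" "count_space UNIV" "complex_of_real B"] B by simp
    also have "\<dots> < \<infinity>" using W(2) by (simp add: ennreal_mult_less_top le_less_trans)
    finally show ?thesis using s by (simp add: Lp_space_def)
  qed
  ultimately show ?thesis
    unfolding bounded_matrices_def using le_less_trans[OF op] by auto
qed

section \<open>Multipliers from factorizations\<close>

text \<open>F is the norm of the section for a finite exponent and 1 for the infinite one. Thus the
  modular of F collects the modulars of all entries.\<close>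

lemma unit_seq_normalise:
  assumes "admissible P" "P = 0 \<longrightarrow> (\<forall>j<n. cmod (V j) \<le> 1)"
  obtains F W where "0 \<le> F" "P = 0 \<longrightarrow> F \<le> 1" "unit_seq P n W"
    "\<forall>j<n. V j = complex_of_real F * W j" "modular P F = (\<Sum>j<n. modular P (cmod (V j)))"
proof (cases "P = 0")
  case True
  then show ?thesis using assms by (intro that[of 1 V]) (auto simp: unit_seq_def modular_def)
next
  case False
  then have P: "1 \<le> P" using assms by (auto simp: admissible_def)
  define S where "S = (\<Sum>j<n. cmod (V j) powr P)"
  have S0: "0 \<le> S" by (simp add: S_def sum_nonneg)
  define F where "F = S powr (1/P)"
  have FP: "F powr P = S" using S0 P by (simp add: F_def powr_powr)
  show ?thesis
  \<comment> \<open>If F = 0, division by zero makes W the zero sequence, in agreement with V, and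
    the quotient \<open>S / S\<close> below is 0 instead of 1.\<close>
  proof (rule that[of F "\<lambda>j. V j / complex_of_real F"])
    show "0 \<le> F" "P = 0 \<longrightarrow> F \<le> 1" using False by (auto simp: F_def)
    show "modular P F = (\<Sum>j<n. modular P (cmod (V j)))" using False FP by (simp add: modular_def S_def)
    have "cmod (V j / complex_of_real F) powr P = cmod (V j) powr P / S" for j
      by (simp add: norm_divide powr_divide FP \<open>0 \<le> F\<close>)
    then have "(\<Sum>j<n. cmod (V j / complex_of_real F) powr P) = (\<Sum>j<n. cmod (V j) powr P / S)"
      by simp
    also have "\<dots> = S / S" by (simp add: S_def sum_divide_distrib[symmetric])
    finally have "(\<Sum>j<n. cmod (V j / complex_of_real F) powr P) = S / S" .
    then show "unit_seq P n (\<lambda>j. V j / complex_of_real F)" using False by (simp add: unit_seq_def)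
    have "V j = complex_of_real F * (V j / complex_of_real F)" if "j < n" for j
    proof (cases "S = 0")
      case True
      then have "cmod (V j) powr P = 0" using that sum_nonneg_eq_0_iff[of "{..<n}" "\<lambda>j. cmod (V j) powr P"] by (simp add: S_def)
      then show ?thesis by simp
    qed (simp add: F_def)
    then show "\<forall>j<n. V j = complex_of_real F * (V j / complex_of_real F)" by blast
  qed
qed

text \<open>Young's inequality replaces the product of two norms by a sum of modulars. Unlike the
  product, this sum can be integrated term by term when V and U depend on a point.\<close>

lemma form_bound_Young:
  assumes a: "form_bound P R a K" and adm: "admissible P" "admissible R" and K: "0 \<le> K"
    and d: "d = 1 - 1/P - 1/R" "0 \<le> d"
    and V: "P = 0 \<longrightarrow> (\<forall>j<n. cmod (V j) \<le> 1)" and U: "R = 0 \<longrightarrow> (\<forall>i<n. cmod (U i) \<le> 1)"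
  shows "cmod (bil n a V U) \<le> K * (1/P * (\<Sum>j<n. modular P (cmod (V j))) + 1/R * (\<Sum>i<n. modular R (cmod (U i))) + d)"
proof -
  obtain F W where F: "0 \<le> F" "P = 0 \<longrightarrow> F \<le> 1" "unit_seq P n W"
    "\<forall>j<n. V j = complex_of_real F * W j" "modular P F = (\<Sum>j<n. modular P (cmod (V j)))"
    using unit_seq_normalise[OF adm(1) V] by blast
  obtain G X where G: "0 \<le> G" "R = 0 \<longrightarrow> G \<le> 1" "unit_seq R n X"
    "\<forall>j<n. U j = complex_of_real G * X j" "modular R G = (\<Sum>j<n. modular R (cmod (U j)))"
    using unit_seq_normalise[OF adm(2) U] by blast
  have "bil n a V U = complex_of_real F * complex_of_real G * bil n a W X"
    unfolding bil_scale[symmetric] using F(4) G(4) by (intro bil_cong) auto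
  then have "cmod (bil n a V U) = (F * G) * cmod (bil n a W X)"
    using F(1) G(1) by (simp add: norm_mult)
  also have "\<dots> \<le> (F * G) * K"
    using a F G unfolding form_bound_def by (intro mult_left_mono) auto
  also have "\<dots> \<le> (1/P * modular P F + 1/R * modular R G + d) * K"
    using assms F G by (intro mult_right_mono Young_three) auto
  finally show ?thesis using F G by (simp add: mult.commute)
qed

lemma form_bound_schur_product:
  fixes x y :: "nat \<Rightarrow> 'a \<Rightarrow> complex"
  assumes p: "1 \<le> p" and r: "1 \<le> r"
  defines "P \<equiv> enn2real p" and "R \<equiv> enn2real r"
  assumes d: "d = 1 - 1/P - 1/R" "0 \<le> d" "d \<noteq> 0 \<longrightarrow> prob_space M"
    and x: "\<And>j. x j \<in> borel_measurable M" "\<And>j. Lp_norm M p (x j) \<le> 1"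
    and y: "\<And>i. y i \<in> borel_measurable M" "\<And>i. Lp_norm M r (y i) \<le> 1"
    and a: "form_bound P R a K" and K: "0 \<le> K"
  shows "form_bound P R (schur_product (\<lambda>i j. pairing M (x j) (y i)) a) K"
  unfolding form_bound_def
proof (intro allI impI)
  fix n V U
  assume V: "unit_seq P n V" and U: "unit_seq R n U"
  have adm: "admissible P" "admissible R" using p r by (auto simp: P_def R_def admissible_enn2real)
  note X = Lp_norm_le_1_modular[OF p x, folded P_def]
  note Y = Lp_norm_le_1_modular[OF r y, folded R_def]
  \<comment> \<open>The total mass of M enters only through d; for \<open>d = 0\<close> it may be
    infinite.\<close>
  have int_d: "integrable M (\<lambda>w. d)" and d_le: "(\<integral>w. d \<partial>M) = d"
  proof -
    have "integrable M (\<lambda>w. d) \<and> (\<integral>w. d \<partial>M) = d"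
    proof (cases "d = 0")
      case False
      then interpret prob_space M using d(3) by blast
      show ?thesis by (simp add: prob_space)
    qed simp
    then show "integrable M (\<lambda>w. d)" "(\<integral>w. d \<partial>M) = d" by auto
  qed
  have X1: "AE w in M. P = 0 \<longrightarrow> (\<forall>j. cmod (x j w) \<le> 1)"
    using X(3) by (cases "P = 0") (auto simp: AE_all_countable)
  have Y1: "AE w in M. R = 0 \<longrightarrow> (\<forall>i. cmod (y i w) \<le> 1)"
    using Y(3) by (cases "R = 0") (auto simp: AE_all_countable)
  \<comment> \<open>The hypotheses bound no product directly; Young's inequality again provides an
    integrable majorant.\<close>
  have int_xy: "integrable M (\<lambda>w. x j w * y i w)" for i j
  proof (rule Bochner_Integration.integrable_bound)
    show "integrable M (\<lambda>w. 1/P * modular P (cmod (x j w)) + 1/R * modular R (cmod (y i w)) + d)"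
      using X(1) Y(1) int_d by (intro Bochner_Integration.integrable_add integrable_mult_right)
    show "AE w in M. norm (x j w * y i w) \<le> norm (1/P * modular P (cmod (x j w)) + 1/R * modular R (cmod (y i w)) + d)"
      using X1 Y1
    proof eventually_elim
      case (elim w)
      then have "cmod (x j w) * cmod (y i w) \<le> 1/P * modular P (cmod (x j w)) + 1/R * modular R (cmod (y i w)) + d"
        using adm d by (intro Young_three) auto
      then show ?case by (simp add: norm_mult)
    qed
  qed (use x y in measurable)
  define V' where "V' w j = V j * x j w" for w j
  define U' where "U' w i = U i * y i w" for w i
  have bil_eq: "bil n a (V' w) (U' w) = (\<Sum>i<n. \<Sum>j<n. a i j * V j * U i * (x j w * y i w))" for w
    unfolding bil_def V'_def U'_def by (intro sum.cong refl) (simp add: mult_ac)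
  have int_bil: "integrable M (\<lambda>w. bil n a (V' w) (U' w))"
    unfolding bil_eq by (intro Bochner_Integration.integrable_sum integrable_mult_right int_xy)
  have "bil n (schur_product (\<lambda>i j. pairing M (x j) (y i)) a) V U = (\<integral>w. bil n a (V' w) (U' w) \<partial>M)"
    unfolding bil_eq
    by (simp add: Bochner_Integration.integral_sum int_xy bil_def schur_product_def pairing_def mult_ac)
  also have "cmod \<dots> \<le> (\<integral>w. cmod (bil n a (V' w) (U' w)) \<partial>M)"
    by (rule integral_norm_bound)
  also have "\<dots> \<le> (\<integral>w. K * (1/P * (\<Sum>j<n. modular P (cmod (V j)) * modular P (cmod (x j w)))
      + 1/R * (\<Sum>i<n. modular R (cmod (U i)) * modular R (cmod (y i w))) + d) \<partial>M)"
  proof (rule integral_mono_AE)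
    show "integrable M (\<lambda>w. cmod (bil n a (V' w) (U' w)))" using int_bil by simp
    show "integrable M (\<lambda>w. K * (1/P * (\<Sum>j<n. modular P (cmod (V j)) * modular P (cmod (x j w)))
      + 1/R * (\<Sum>i<n. modular R (cmod (U i)) * modular R (cmod (y i w))) + d))"
      using X(1) Y(1) int_d
      by (intro Bochner_Integration.integrable_add integrable_mult_right Bochner_Integration.integrable_sum)
    show "AE w in M. cmod (bil n a (V' w) (U' w)) \<le> K * (1/P * (\<Sum>j<n. modular P (cmod (V j)) * modular P (cmod (x j w)))
      + 1/R * (\<Sum>i<n. modular R (cmod (U i)) * modular R (cmod (y i w))) + d)"
      using X1 Y1
    proof eventually_elim
      case (elim w)
      have VP: "modular P (cmod (V' w j)) = modular P (cmod (V j)) * modular P (cmod (x j w))" for j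
        by (simp add: V'_def norm_mult modular_def powr_mult)
      have UR: "modular R (cmod (U' w j)) = modular R (cmod (U j)) * modular R (cmod (y j w))" for j
        by (simp add: U'_def norm_mult modular_def powr_mult)
      have "P = 0 \<longrightarrow> (\<forall>j<n. cmod (V' w j) \<le> 1)" "R = 0 \<longrightarrow> (\<forall>j<n. cmod (U' w j) \<le> 1)"
        using elim unit_seq_le_1[OF adm(1) V] unit_seq_le_1[OF adm(2) U]
        by (auto simp: V'_def U'_def norm_mult intro!: mult_le_one)
      from form_bound_Young[OF a adm K d(1,2) this]
      show ?case unfolding VP UR .
    qed
  qed
  also have "\<dots> = K * (1/P * (\<Sum>j<n. modular P (cmod (V j)) * (\<integral>w. modular P (cmod (x j w)) \<partial>M))
      + 1/R * (\<Sum>i<n. modular R (cmod (U i)) * (\<integral>w. modular R (cmod (y i w)) \<partial>M)) + d)"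
    using X(1) Y(1) int_d d_le by simp
  \<comment> \<open>First the mean modulars of the functions are replaced by 1, then the modular
    sums of V and U; what remains are the three weights, of sum 1.\<close>
  also have "\<dots> \<le> K * (1/P * (\<Sum>j<n. modular P (cmod (V j)) * 1) + 1/R * (\<Sum>i<n. modular R (cmod (U i)) * 1) + d)"
    using X(2) Y(2) K adm
    by (intro mult_left_mono add_mono sum_mono admissible_inverse modular_nonneg) auto
  also have "\<dots> \<le> K * (1/P * 1 + 1/R * 1 + d)"
    using modular_sum_unit_seq[OF V] modular_sum_unit_seq[OF U] K adm
    by (intro mult_left_mono add_mono admissible_inverse) auto
  also have "\<dots> = K" using d by simp
  finally show "cmod (bil n (schur_product (\<lambda>i j. pairing M (x j) (y i)) a) V U) \<le> K" .
qed

lemma form_bound_scale: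
  "form_bound P R a K \<Longrightarrow> form_bound P R (\<lambda>i j. s * a i j) (cmod s * K)"
proof -
  have "bil n (\<lambda>i j. s * a i j) V U = s * bil n a V U" for n V U
    by (simp add: bil_def sum_distrib_left mult_ac)
  then show "form_bound P R a K \<Longrightarrow> form_bound P R (\<lambda>i j. s * a i j) (cmod s * K)"
    by (auto simp: form_bound_def norm_mult intro!: mult_left_mono)
qed

text \<open>Here d turns out to be 1/q - 1/p. The assumption \<open>q \<le> p\<close> enters at this
  point, as nonnegativity of the third weight in Young's inequality.\<close>

lemma exponent_gap:
  assumes "1 \<le> q" "q \<le> p"
  defines "d \<equiv> 1 - 1 / enn2real p - 1 / enn2real (conj_exponent q)"
  shows "0 \<le> d" "d = 0 \<longleftrightarrow> p = q"
proof -
  have p: "1 \<le> p" using assms by auto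
  have d: "d = 1 / enn2real q - 1 / enn2real p"
    using inverse_conj_exponent[OF assms(1)] by (simp add: d_def)
  have "0 \<le> d \<and> (d = 0 \<longleftrightarrow> p = q)"
    using assms(1)
  proof (cases rule: ennreal_exponent_cases)
    case infinite
    then show ?thesis using assms(2) d by (simp add: top_unique)
  next
    case q: finite
    show ?thesis
      using p
    proof (cases rule: ennreal_exponent_cases)
      case infinite
      then show ?thesis using q d by auto
    next
      case finite
      have "enn2real q \<le> enn2real p" using assms(2) q(3) finite(3)
        by (metis enn2real_nonneg ennreal_le_iff)
      then have "1 / enn2real p \<le> 1 / enn2real q" using q by (intro divide_left_mono) auto
      moreover have "d = 0 \<longleftrightarrow> enn2real p = enn2real q" using q finite d by (auto simp: field_simps)
      moreover have "enn2real p = enn2real q \<longleftrightarrow> p = q" using q(3) finite(3) by metis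
      ultimately show ?thesis unfolding d by simp
    qed
  qed
  then show "0 \<le> d" "d = 0 \<longleftrightarrow> p = q" by auto
qed

lemma factorization_on_imp_form_bound:
  fixes M :: "'a measure"
  assumes q: "1 \<le> q" and qp: "q \<le> p" and C: "0 \<le> C" and K: "0 \<le> K"
    and fac: "factorization_on M p q c C"
    and a: "form_bound (enn2real p) (enn2real (conj_exponent q)) a K"
  shows "form_bound (enn2real p) (enn2real (conj_exponent q)) (schur_product c a) (C * K)"
proof -
  define r where "r = conj_exponent q"
  have p: "1 \<le> p" and r: "1 \<le> r" using q qp one_le_conj_exponent by (auto simp: r_def)
  obtain x y where x: "\<And>j. x j \<in> Lp_space M p" "(SUP j. Lp_norm M p (x j)) < \<infinity>"
    and y: "\<And>i. y i \<in> Lp_space M r" "(SUP i. Lp_norm M r (y i)) < \<infinity>"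
    and cxy: "\<And>i j. c i j = pairing M (x j) (y i)"
    and le: "(SUP i. Lp_norm M r (y i)) * (SUP j. Lp_norm M p (x j)) \<le> ennreal C"
    using fac unfolding factorization_on_def r_def by blast
  have prob: "p \<noteq> q \<longrightarrow> prob_space M" using fac unfolding factorization_on_def by blast
  define X where "X = enn2real (SUP j. Lp_norm M p (x j))"
  define Y where "Y = enn2real (SUP i. Lp_norm M r (y i))"
  have X: "ennreal X = (SUP j. Lp_norm M p (x j))" "0 \<le> X" using x(2) by (auto simp: X_def)
  have Y: "ennreal Y = (SUP i. Lp_norm M r (y i))" "0 \<le> Y" using y(2) by (auto simp: Y_def)
  have YX: "Y * X \<le> C" using le C X(2) Y(2)
    unfolding X(1)[symmetric] Y(1)[symmetric] by (simp add: ennreal_mult[symmetric])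
  define d where "d = 1 - 1 / enn2real p - 1 / enn2real r"
  have d: "0 \<le> d" "d \<noteq> 0 \<longrightarrow> prob_space M" using exponent_gap[OF q qp] prob by (auto simp: d_def r_def)
  \<comment> \<open>The suprema may be 0, so the families are normalised by X + e and Y + e, and e
    tends to 0 at the end.\<close>
  have eps: "form_bound (enn2real p) (enn2real r) (schur_product c a) ((Y + e) * (X + e) * K)" if e: "0 < e" for e :: real
  proof -
    define x' where "x' j w = complex_of_real (1/(X+e)) * x j w" for j w
    define y' where "y' i w = complex_of_real (1/(Y+e)) * y i w" for i w
    have mx: "x j \<in> borel_measurable M" and my: "y j \<in> borel_measurable M" for j
      using x y by (auto simp: Lp_space_def)
    have x'm: "x' j \<in> borel_measurable M" and y'm: "y' j \<in> borel_measurable M" for j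
      using mx my unfolding x'_def[abs_def] y'_def[abs_def] by measurable
    have x'1: "Lp_norm M p (x' j) \<le> 1" for j
    proof -
      have "Lp_norm M p (x j) \<le> ennreal X" unfolding X by (rule SUP_upper) simp
      also have "\<dots> \<le> ennreal (X + e)" using e by (intro ennreal_leI) simp
      finally show ?thesis using Lp_norm_le_iff[OF p mx, of "X + e"] X e unfolding x'_def[abs_def] by simp
    qed
    have y'1: "Lp_norm M r (y' j) \<le> 1" for j
    proof -
      have "Lp_norm M r (y j) \<le> ennreal Y" unfolding Y by (rule SUP_upper) simp
      also have "\<dots> \<le> ennreal (Y + e)" using e by (intro ennreal_leI) simp
      finally show ?thesis using Lp_norm_le_iff[OF r my, of "Y + e"] Y e unfolding y'_def[abs_def] by simp
    qed
    have "form_bound (enn2real p) (enn2real r) (schur_product (\<lambda>i j. pairing M (x' j) (y' i)) a) K"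
      using form_bound_schur_product[OF p r d_def d x'm x'1 y'm y'1 _ K] a by (simp add: r_def)
    from form_bound_scale[OF this, of "complex_of_real ((Y + e) * (X + e))"]
    have "form_bound (enn2real p) (enn2real r)
       (\<lambda>i j. complex_of_real ((Y + e) * (X + e)) * schur_product (\<lambda>i j. pairing M (x' j) (y' i)) a i j)
       ((Y + e) * (X + e) * K)" using X Y e by (simp add: norm_mult del: of_real_mult of_real_add)
    also have "(\<lambda>i j. complex_of_real ((Y + e) * (X + e)) * schur_product (\<lambda>i j. pairing M (x' j) (y' i)) a i j) = schur_product c a"
    proof (intro ext)
      fix i j
      have "(\<lambda>w. x' j w * y' i w) = (\<lambda>w. complex_of_real (1/(X+e) * (1/(Y+e))) * (x j w * y i w))"
        by (auto simp: x'_def y'_def)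
      then have "pairing M (x' j) (y' i) = complex_of_real (1/(X+e) * (1/(Y+e))) * c i j"
        unfolding cxy pairing_def by (metis integral_mult_right_zero)
      then have "complex_of_real ((Y + e) * (X + e)) * pairing M (x' j) (y' i) 
        = complex_of_real (((Y + e) * (X + e)) * (1/(X+e) * (1/(Y+e)))) * c i j"
        by (simp only: of_real_mult mult.assoc)
      also have "((Y + e) * (X + e)) * (1/(X+e) * (1/(Y+e))) = 1"
      proof -
        have "Y + e \<noteq> 0" "X + e \<noteq> 0" using X(2) Y(2) e by auto
        then show ?thesis by simp
      qed
      finally show "complex_of_real ((Y + e) * (X + e)) * schur_product (\<lambda>i j. pairing M (x' j) (y' i)) a i j = schur_product c a i j"
        by (simp add: schur_product_def del: of_real_mult of_real_add flip: mult.assoc)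
    qed
    finally show ?thesis .
  qed
  show ?thesis unfolding form_bound_def r_def[symmetric]
  proof (intro allI impI)
    fix n V U assume VU: "unit_seq (enn2real p) n V" "unit_seq (enn2real r) n U"
    have "((\<lambda>e. (Y + e) * (X + e) * K) \<longlongrightarrow> (Y + 0) * (X + 0) * K) (at_right 0)"
      by (intro tendsto_mult tendsto_add tendsto_const tendsto_ident_at)
    moreover have "\<forall>\<^sub>F e in at_right 0. cmod (bil n (schur_product c a) V U) \<le> (Y + e) * (X + e) * K"
      using eps VU unfolding form_bound_def by (auto intro: eventually_mono[OF eventually_at_right_less])
    ultimately have "cmod (bil n (schur_product c a) V U) \<le> (Y + 0) * (X + 0) * K"
      by (intro tendsto_lowerbound) auto
    also have "\<dots> \<le> C * K" using YX K by (simp add: mult_right_mono)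
    finally show "cmod (bil n (schur_product c a) V U) \<le> C * K" .
  qed
qed

lemma factorization_on_imp_schur:
  fixes M :: "'a measure"
  assumes q: "1 \<le> q" and qp: "q \<le> p" and C: "0 \<le> C" and fac: "factorization_on M p q c C"
  shows "schur_multiplier p q c \<and> schur_norm p q c \<le> ennreal C"
proof -
  have p: "1 \<le> p" using q qp by auto
  have key: "schur_product c a \<in> bounded_matrices p q \<and> matrix_opnorm p q (schur_product c a) \<le> ennreal (C * K)"
    if "0 \<le> K" "a \<in> bounded_matrices p q" "matrix_opnorm p q a \<le> ennreal K" for a K
    using factorization_on_imp_form_bound[OF q qp C \<open>0 \<le> K\<close> fac opnorm_le_form_bound[OF p q that]]
      form_bound_imp_bounded[OF p q, of "C * K"] C that by simp
  have "schur_product c a \<in> bounded_matrices p q" if "a \<in> bounded_matrices p q" for a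
  proof -
    have "matrix_opnorm p q a \<le> ennreal (enn2real (matrix_opnorm p q a))"
      using that by (simp add: bounded_matrices_def)
    then show ?thesis using key[OF enn2real_nonneg that] by blast
  qed
  moreover have "schur_norm p q c \<le> ennreal C"
    unfolding schur_norm_def using key[of 1] by (intro SUP_least) auto
  ultimately show ?thesis by (simp add: schur_multiplier_def)
qed

section \<open>Approximate factorization of finite sections\<close>

text \<open>
  Blackwell's approachability argument: every new point is chosen against the current error vector,
  so the squared error of the sums grows only linearly in their length.
\<close>

lemma approachability:
  fixes f :: "'x \<Rightarrow> 'i \<Rightarrow> complex" and g :: "'x \<Rightarrow> 'k \<Rightarrow> real"
  assumes bound: "\<And>x. x \<in> X \<Longrightarrow> (\<Sum>i\<in>A. (cmod (f x i))\<^sup>2) + (\<Sum>k\<in>B. (g x k)\<^sup>2) \<le> D"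
    and step: "\<And>b s. (\<And>k. 0 \<le> s k) \<Longrightarrow>
      \<exists>x\<in>X. Re (\<Sum>i\<in>A. b i * f x i) + (\<Sum>k\<in>B. s k * g x k) \<le> 1"
  shows "\<exists>xs. (\<forall>m<N. xs m \<in> X) \<and>
    (\<Sum>i\<in>A. (cmod (\<Sum>m<N. f (xs m) i))\<^sup>2) + (\<Sum>k\<in>B. (max 0 (\<Sum>m<N. g (xs m) k))\<^sup>2) \<le> real N * (D + 2)"
proof (induction N)
  case 0
  then show ?case by simp
next
  case (Suc N)
  then obtain xs where xs: "\<And>m. m < N \<Longrightarrow> xs m \<in> X"
    and IH: "(\<Sum>i\<in>A. (cmod (\<Sum>m<N. f (xs m) i))\<^sup>2) + (\<Sum>k\<in>B. (max 0 (\<Sum>m<N. g (xs m) k))\<^sup>2) \<le> real N * (D + 2)"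
    by blast
  define F where "F i = (\<Sum>m<N. f (xs m) i)" for i
  define G where "G k = (\<Sum>m<N. g (xs m) k)" for k
  \<comment> \<open>The functional is the current error itself; of the inequality constraints only
    the excess counts.\<close>
  obtain x where x: "x \<in> X" "Re (\<Sum>i\<in>A. cnj (F i) * f x i) + (\<Sum>k\<in>B. max 0 (G k) * g x k) \<le> 1"
    using step[of "\<lambda>k. max 0 (G k)" "\<lambda>i. cnj (F i)"] by auto
  define ys where "ys = xs(N := x)"
  have F': "(\<Sum>m<Suc N. f (ys m) i) = F i + f x i" for i
    by (simp add: ys_def F_def)
  have G': "(\<Sum>m<Suc N. g (ys m) k) = G k + g x k" for k
    by (simp add: ys_def G_def)
  have eF: "(cmod (F i + f x i))\<^sup>2 = (cmod (F i))\<^sup>2 + 2 * Re (cnj (F i) * f x i) + (cmod (f x i))\<^sup>2" for i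
    unfolding cmod_power2 by (simp add: power2_eq_square algebra_simps)
  have eG: "(max 0 (G k + g x k))\<^sup>2 \<le> (max 0 (G k))\<^sup>2 + 2 * (max 0 (G k) * g x k) + (g x k)\<^sup>2" for k
  proof -
    have "(max 0 (G k + g x k))\<^sup>2 \<le> (max 0 (G k) + g x k)\<^sup>2"
      unfolding abs_le_square_iff[symmetric] by linarith
    then show ?thesis by (simp add: power2_eq_square algebra_simps)
  qed
  have "(\<Sum>i\<in>A. (cmod (F i + f x i))\<^sup>2) + (\<Sum>k\<in>B. (max 0 (G k + g x k))\<^sup>2)
    \<le> (\<Sum>i\<in>A. (cmod (F i))\<^sup>2 + 2 * Re (cnj (F i) * f x i) + (cmod (f x i))\<^sup>2)
      + (\<Sum>k\<in>B. (max 0 (G k))\<^sup>2 + 2 * (max 0 (G k) * g x k) + (g x k)\<^sup>2)"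
    unfolding eF by (intro add_left_mono sum_mono eG)
  also have "\<dots> = ((\<Sum>i\<in>A. (cmod (F i))\<^sup>2) + (\<Sum>k\<in>B. (max 0 (G k))\<^sup>2))
      + 2 * (Re (\<Sum>i\<in>A. cnj (F i) * f x i) + (\<Sum>k\<in>B. max 0 (G k) * g x k))
      + ((\<Sum>i\<in>A. (cmod (f x i))\<^sup>2) + (\<Sum>k\<in>B. (g x k)\<^sup>2))"
    by (simp only: sum.distrib sum_distrib_left[symmetric] Re_sum distrib_left add_ac)
  \<comment> \<open>The cross term adds at most 2, the square of the new point at most D.\<close>
  also have "\<dots> \<le> real N * (D + 2) + 2 * 1 + D"
    using IH x(2) bound[OF x(1)] unfolding F_def[symmetric] G_def[symmetric]
    by (intro add_mono mult_left_mono) auto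
  finally have "(\<Sum>i\<in>A. (cmod (F i + f x i))\<^sup>2) + (\<Sum>k\<in>B. (max 0 (G k + g x k))\<^sup>2) \<le> real (Suc N) * (D + 2)"
    by (simp add: algebra_simps)
  moreover have "\<forall>m<Suc N. ys m \<in> X" using xs x by (auto simp: ys_def less_Suc_eq)
  ultimately show ?case unfolding F'[symmetric] G'[symmetric] by blast
qed

section \<open>The dual step for a multiplier\<close>

definition multiplier_bound :: "real \<Rightarrow> real \<Rightarrow> cmatrix \<Rightarrow> real \<Rightarrow> bool" where
  "multiplier_bound P R c C \<longleftrightarrow>
     (\<forall>a K. 0 < K \<longrightarrow> form_bound P R a K \<longrightarrow> form_bound P R (schur_product c a) (C * K))"

lemma schur_imp_multiplier_bound:
  assumes p: "1 \<le> p" and q: "1 \<le> q" and C: "0 \<le> C"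
    and c: "schur_multiplier p q c" "schur_norm p q c \<le> ennreal C"
  shows "multiplier_bound (enn2real p) (enn2real (conj_exponent q)) c C"
  unfolding multiplier_bound_def
proof (intro allI impI)
  fix a K assume K: "0 < (K::real)" and a: "form_bound (enn2real p) (enn2real (conj_exponent q)) a K"
  define b where "b = (\<lambda>i j. complex_of_real (1/K) * a i j)"
  have "form_bound (enn2real p) (enn2real (conj_exponent q)) b 1"
    using form_bound_scale[OF a, of "complex_of_real (1/K)"] K by (simp add: b_def norm_divide)
  then have b: "b \<in> bounded_matrices p q" "matrix_opnorm p q b \<le> 1"
    using form_bound_imp_bounded[OF p q, of 1 b] by auto
  then have "schur_product c b \<in> bounded_matrices p q"
    using c(1) by (simp add: schur_multiplier_def)
  moreover have "matrix_opnorm p q (schur_product c b) \<le> ennreal C"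
    using b c(2) unfolding schur_norm_def by (auto simp: SUP_le_iff)
  ultimately have "form_bound (enn2real p) (enn2real (conj_exponent q)) (schur_product c b) C"
    using opnorm_le_form_bound[OF p q C] by blast
  from form_bound_scale[OF this, of "complex_of_real K"]
  show "form_bound (enn2real p) (enn2real (conj_exponent q)) (schur_product c a) (C * K)"
    using K by (simp add: schur_product_def b_def mult.commute)
qed

text \<open>Turns the weights of a linear constraint into a test vector. If \<open>z j\<close> is
  the P-th root of \<open>S j / A\<close>, then S_j |V_j / z_j|^P = A |V_j|^P, and these terms sum
  to at most A. For P = 0 the exponent 1/P is 0 and z is identically 1.\<close>

lemma weighted_unit_seq:
  assumes P: "admissible P" and n: "0 < n" and s: "\<And>j. 0 \<le> s j" and e: "0 < (e::real)"
  obtains z :: "nat \<Rightarrow> real" where "\<forall>j. 0 < z j" "P = 0 \<longrightarrow> (\<forall>j. z j = 1)"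
    "unit_seq P n (\<lambda>j. complex_of_real (z j))"
    "\<forall>V. unit_seq P n V \<longrightarrow> (\<Sum>j<n. s j * modular P (cmod (V j) / z j)) \<le> (\<Sum>j<n. s j) + e"
proof -
  \<comment> \<open>The extra e/n keeps every weight positive, so that division by
    \<open>z j\<close> makes sense; the total cost is e.\<close>
  define S where "S j = s j + e / real n" for j
  define A where "A = (\<Sum>j<n. s j) + e"
  have S: "0 < S j" for j using s[of j] e n by (simp add: S_def add_nonneg_pos)
  have A: "0 < A" using s e by (simp add: A_def sum_nonneg add_nonneg_pos)
  have SA: "(\<Sum>j<n. S j) = A" using n by (simp add: S_def A_def sum.distrib)
  define z where "z j = (S j / A) powr (1/P)" for j
  have z: "0 < z j" for j using S[of j] A by (simp add: z_def)
  have zP: "P \<noteq> 0 \<Longrightarrow> z j powr P = S j / A" for j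
    using S[of j] A by (simp add: z_def powr_powr)
  show ?thesis
  proof (rule that[of z])
    show "P = 0 \<longrightarrow> (\<forall>j. z j = 1)" using S A by (auto simp: z_def less_imp_neq[symmetric])
    show "unit_seq P n (\<lambda>j. complex_of_real (z j))"
    proof (cases "P = 0")
      case True
      then show ?thesis using S A by (auto simp: unit_seq_def z_def)
    next
      case False
      have "(\<Sum>j<n. cmod (complex_of_real (z j)) powr P) = (\<Sum>j<n. S j / A)"
        using z zP[OF False] by (simp add: abs_of_pos)
      also have "\<dots> = 1" using SA A by (simp add: sum_divide_distrib[symmetric])
      finally show ?thesis using False by (simp add: unit_seq_def)
    qed
    have "(\<Sum>j<n. s j * modular P (cmod (V j) / z j)) \<le> (\<Sum>j<n. s j) + e" if V: "unit_seq P n V" for V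
    proof (cases "P = 0")
      case True
      then show ?thesis using A by (simp add: modular_def A_def)
    next
      case False
      have "s j * modular P (cmod (V j) / z j) \<le> A * modular P (cmod (V j))" for j
      proof -
        have "s j * modular P (cmod (V j) / z j) = (s j / S j) * (A * modular P (cmod (V j)))"
          using False z[of j] zP[of j] by (simp add: modular_def powr_divide)
        also have "\<dots> \<le> 1 * (A * modular P (cmod (V j)))"
          using S[of j] e n A by (intro mult_right_mono mult_nonneg_nonneg modular_nonneg) (auto simp: S_def)
        finally show ?thesis by simp
      qed
      then have "(\<Sum>j<n. s j * modular P (cmod (V j) / z j)) \<le> (\<Sum>j<n. A * modular P (cmod (V j)))"
        by (intro sum_mono)
      also have "\<dots> \<le> A * 1" unfolding sum_distrib_left[symmetric]
        using modular_sum_unit_seq[OF V] A by (intro mult_left_mono) auto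
      finally show ?thesis by (simp add: A_def)
    qed
    then show "\<forall>V. unit_seq P n V \<longrightarrow> (\<Sum>j<n. s j * modular P (cmod (V j) / z j)) \<le> (\<Sum>j<n. s j) + e"
      by blast
  qed (use z in blast)
qed

lemma bil_truncate:
  assumes a: "\<And>i j. n \<le> i \<or> n \<le> j \<Longrightarrow> a i j = 0"
  shows "bil m a V U = bil n a (\<lambda>j. if j < m then V j else 0) (\<lambda>i. if i < m then U i else 0)"
proof -
  define k where "k = max m n"
  define V' where "V' = (\<lambda>j. if j < m then V j else 0)"
  define U' where "U' = (\<lambda>j. if j < m then U j else 0)"
  have "bil m a V U = bil m a V' U'" by (rule bil_cong) (auto simp: V'_def U'_def)
  also have "\<dots> = bil k a V' U'" unfolding bil_def
    by (intro sum.mono_neutral_cong_left ballI) (auto simp: k_def V'_def U'_def intro!: sum.mono_neutral_left sum.neutral)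
  also have "\<dots> = bil n a V' U'" unfolding bil_def
    by (intro sum.mono_neutral_cong_right ballI) (auto simp: k_def a intro!: sum.mono_neutral_right sum.neutral)
  finally show ?thesis by (simp add: V'_def U'_def)
qed

lemma form_bound_attained:
  assumes adm: "admissible P" "admissible R" and a: "\<And>i j. n \<le> i \<or> n \<le> j \<Longrightarrow> a i j = 0" and e: "0 < e"
  obtains K V U where "0 < K" "form_bound P R a K" "unit_seq P n V" "unit_seq R n U"
    "K - e \<le> cmod (bil n a V U)"
proof -
  define T where "T = {cmod (bil n a V U) | V U. unit_seq P n V \<and> unit_seq R n U}"
  have "cmod (bil n a V U) \<le> (\<Sum>i<n. \<Sum>j<n. cmod (a i j))" if "unit_seq P n V" "unit_seq R n U" for V U
  proof -
    have "cmod (bil n a V U) \<le> (\<Sum>i<n. \<Sum>j<n. cmod (a i j * V j * U i))"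
      unfolding bil_def by (rule order_trans[OF norm_sum]) (intro sum_mono norm_sum)
    also have "\<dots> \<le> (\<Sum>i<n. \<Sum>j<n. cmod (a i j) * 1 * 1)"
      unfolding norm_mult using unit_seq_le_1[OF adm(1) that(1)] unit_seq_le_1[OF adm(2) that(2)]
      by (intro sum_mono mult_mono) auto
    finally show ?thesis by simp
  qed
  then have bdd: "bdd_above T" unfolding T_def by (intro bdd_aboveI) blast
  have ne: "0 \<in> T" unfolding T_def
    by (rule CollectI, rule exI[of _ "\<lambda>_. 0"], rule exI[of _ "\<lambda>_. 0"]) (auto simp: bil_def unit_seq_def)
  define K where "K = Sup T"
  have K0: "0 \<le> K" unfolding K_def using ne bdd by (rule cSup_upper)
  have "form_bound P R a K" unfolding form_bound_def
  proof (intro allI impI)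
    fix m V U assume VU: "unit_seq P m V" "unit_seq R m U"
    have "bil m a V U = bil n a (\<lambda>j. if j < m then V j else 0) (\<lambda>i. if i < m then U i else 0)"
      by (rule bil_truncate) (rule a)
    then have "cmod (bil m a V U) \<in> T"
      unfolding T_def mem_Collect_eq
      using unit_seq_truncate[OF VU(1), of n] unit_seq_truncate[OF VU(2), of n]
      by (intro exI[of _ "\<lambda>j. if j < m then V j else 0"] exI[of _ "\<lambda>i. if i < m then U i else 0"]) simp
    then show "cmod (bil m a V U) \<le> K" unfolding K_def using bdd by (rule cSup_upper)
  qed
  \<comment> \<open>Half of e makes the bound positive, as \<open>multiplier_bound\<close> demands;
    the other half is the gap below the supremum.\<close>
  then have 1: "form_bound P R a (K + e/2)" using e unfolding form_bound_def by (smt (verit) half_gt_zero)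
  have "K - e/2 < Sup T" using e by (simp add: K_def)
  then obtain t where "t \<in> T" "K - e/2 < t" using ne less_cSupE[of "K - e/2" T] by blast
  then obtain V U where "unit_seq P n V" "unit_seq R n U" "K - e/2 < cmod (bil n a V U)"
    unfolding T_def by blast
  then show ?thesis using that[of "K + e/2" V U] 1 K0 e by auto
qed

text \<open>The test matrix is b_ij / (z_j w_i). The form of its Schur product with c at (z, w) is
  the sum of the b_ij c_ij. Nearly extremal vectors V, U for the test matrix itself give v = V/z and
  u = U/w, and the modulus of the sum of the b_ij v_j u_i is close to the bound K. The multiplier
  property says that C times the latter dominates the former, up to a small error.\<close>

lemma multiplier_bound_dual_step:
  assumes adm: "admissible P" "admissible R" and C: "0 \<le> C" and c: "multiplier_bound P R c C" and n: "0 < n"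
    and s: "\<And>j. 0 \<le> s j" and t: "\<And>i. 0 \<le> t i"
  obtains v u where "P = 0 \<longrightarrow> (\<forall>j. cmod (v j) \<le> 1)" "R = 0 \<longrightarrow> (\<forall>i. cmod (u i) \<le> 1)"
    "\<And>j. n \<le> j \<Longrightarrow> v j = 0" "\<And>i. n \<le> i \<Longrightarrow> u i = 0"
    "Re (\<Sum>i<n. \<Sum>j<n. b i j * (complex_of_real C * (v j * u i) - c i j))
      + (\<Sum>j<n. s j * (modular P (cmod (v j)) - 1)) + (\<Sum>i<n. t i * (modular R (cmod (u i)) - 1)) \<le> 1"
proof -
  obtain z :: "nat \<Rightarrow> real" where z: "\<forall>j. 0 < z j" "P = 0 \<longrightarrow> (\<forall>j. z j = 1)"
    "unit_seq P n (\<lambda>j. complex_of_real (z j))"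
    "\<forall>V. unit_seq P n V \<longrightarrow> (\<Sum>j<n. s j * modular P (cmod (V j) / z j)) \<le> (\<Sum>j<n. s j) + 1/8"
    by (rule weighted_unit_seq[OF adm(1) n s, where e = "1/8"]) simp
  obtain w :: "nat \<Rightarrow> real" where w: "\<forall>j. 0 < w j" "R = 0 \<longrightarrow> (\<forall>j. w j = 1)"
    "unit_seq R n (\<lambda>j. complex_of_real (w j))"
    "\<forall>V. unit_seq R n V \<longrightarrow> (\<Sum>j<n. t j * modular R (cmod (V j) / w j)) \<le> (\<Sum>j<n. t j) + 1/8"
    by (rule weighted_unit_seq[OF adm(2) n t, where e = "1/8"]) simp
  define a where "a i j = (if i < n \<and> j < n then b i j / complex_of_real (z j * w i) else 0)" for i j
  \<comment> \<open>C + 1 in place of C allows for C = 0. The errors 1/4, 1/8 and 1/8 add up to 1/2,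
    within the permitted 1.\<close>
  define e where "e = 1 / (4 * (C + 1))"
  have e: "0 < e" "C * e \<le> 1/4" using C by (auto simp: e_def field_simps)
  obtain K V U where K: "0 < K" "form_bound P R a K" and V: "unit_seq P n V" and U: "unit_seq R n U"
    and VU: "K - e \<le> cmod (bil n a V U)"
    by (rule form_bound_attained[OF adm, where n = n and a = a and e = e]) (use e in \<open>auto simp: a_def\<close>)
  have "form_bound P R (schur_product c a) (C * K)"
    using c K by (simp add: multiplier_bound_def)
  then have "cmod (bil n (schur_product c a) (\<lambda>j. complex_of_real (z j)) (\<lambda>i. complex_of_real (w i))) \<le> C * K"
    using z w by (simp add: form_bound_def)
  also have "bil n (schur_product c a) (\<lambda>j. complex_of_real (z j)) (\<lambda>i. complex_of_real (w i)) = (\<Sum>i<n. \<Sum>j<n. b i j * c i j)"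
    unfolding bil_def schur_product_def a_def using z(1) w(1)
    by (intro sum.cong refl) (simp add: less_imp_neq[symmetric])
  also have "C * K \<le> C * (cmod (bil n a V U) + e)" using VU C by (intro mult_left_mono) auto
  also have "\<dots> \<le> C * cmod (bil n a V U) + 1/4" using e by (simp add: distrib_left)
  finally have bc: "cmod (\<Sum>i<n. \<Sum>j<n. b i j * c i j) \<le> C * cmod (bil n a V U) + 1/4" .
  \<comment> \<open>This phase makes the form at (v, u) real and nonpositive, so that C times it
    absorbs the estimate for the c_ij.\<close>
  define th where "th = (if bil n a V U = 0 then 1 else - cnj (sgn (bil n a V U)))"
  have th1: "cmod th = 1" by (simp add: th_def norm_sgn)
  have th: "th * bil n a V U = - complex_of_real (cmod (bil n a V U))"
    using mult_cnj_sgn[of "bil n a V U"] by (simp add: th_def mult.commute)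
  define v where "v j = (if j < n then th * V j / complex_of_real (z j) else 0)" for j
  define u where "u i = (if i < n then U i / complex_of_real (w i) else 0)" for i
  have cv: "cmod (v j) = cmod (V j) / z j" if "j < n" for j
    using that z(1)[rule_format, of j] th1 by (simp add: v_def norm_divide norm_mult)
  have cu: "cmod (u j) = cmod (U j) / w j" if "j < n" for j
    using that w(1)[rule_format, of j] by (simp add: u_def norm_divide)
  have buv: "(\<Sum>i<n. \<Sum>j<n. b i j * (v j * u i)) = th * bil n a V U"
    unfolding bil_def sum_distrib_left by (intro sum.cong refl) (simp add: a_def v_def u_def)
  have "(\<Sum>i<n. \<Sum>j<n. b i j * (complex_of_real C * (v j * u i) - c i j))
      = complex_of_real C * (\<Sum>i<n. \<Sum>j<n. b i j * (v j * u i)) - (\<Sum>i<n. \<Sum>j<n. b i j * c i j)"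
    unfolding sum_distrib_left sum_subtractf[symmetric] by (intro sum.cong refl) (simp add: algebra_simps)
  then have "Re (\<Sum>i<n. \<Sum>j<n. b i j * (complex_of_real C * (v j * u i) - c i j))
      = - (C * cmod (bil n a V U)) - Re (\<Sum>i<n. \<Sum>j<n. b i j * c i j)"
    unfolding buv th by simp
  also have "\<dots> \<le> 1/4"
    using bc abs_Re_le_cmod[of "\<Sum>i<n. \<Sum>j<n. b i j * c i j"] by linarith
  finally have 1: "Re (\<Sum>i<n. \<Sum>j<n. b i j * (complex_of_real C * (v j * u i) - c i j)) \<le> 1/4" .
  have "(\<Sum>j<n. s j * (modular P (cmod (v j)) - 1)) = (\<Sum>j<n. s j * modular P (cmod (V j) / z j)) - (\<Sum>j<n. s j)"
    by (simp add: cv right_diff_distrib sum_subtractf)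
  then have 2: "(\<Sum>j<n. s j * (modular P (cmod (v j)) - 1)) \<le> 1/8" using z(4)[rule_format, OF V] by linarith
  have "(\<Sum>j<n. t j * (modular R (cmod (u j)) - 1)) = (\<Sum>j<n. t j * modular R (cmod (U j) / w j)) - (\<Sum>j<n. t j)"
    by (simp add: cu right_diff_distrib sum_subtractf)
  then have 3: "(\<Sum>j<n. t j * (modular R (cmod (u j)) - 1)) \<le> 1/8" using w(4)[rule_format, OF U] by linarith
  show ?thesis
  proof (rule that[of v u])
    show "P = 0 \<longrightarrow> (\<forall>j. cmod (v j) \<le> 1)"
      using z(2) V th1 by (auto simp: v_def unit_seq_def norm_mult)
    show "R = 0 \<longrightarrow> (\<forall>j. cmod (u j) \<le> 1)"
      using w(2) U by (auto simp: u_def unit_seq_def)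
    show "v j = 0" "u j = 0" if "n \<le> j" for j using that by (auto simp: v_def u_def)
    show "Re (\<Sum>i<n. \<Sum>j<n. b i j * (complex_of_real C * (v j * u i) - c i j))
      + (\<Sum>j<n. s j * (modular P (cmod (v j)) - 1)) + (\<Sum>i<n. t i * (modular R (cmod (u i)) - 1)) \<le> 1"
      using 1 2 3 by linarith
  qed
qed

section \<open>A curve filling the product of discs\<close>

text \<open>
  A continuous curve through all sequences in the closed unit disc, after Schoenberg's space-filling
  curve: \<^term>\<open>schoenberg (3 ^ k * t)\<close> reads off the \<open>k\<close>-th ternary digit of \<open>t\<close>, if all these digits
  are 0 or 2.
\<close>

definition schoenberg :: "real \<Rightarrow> real" where
  "schoenberg t = max 0 (min 1 (1/2 - cos (pi * t)))"

lemma schoenberg_bounds: "0 \<le> schoenberg t" "schoenberg t \<le> 1"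
  by (auto simp: schoenberg_def)

lemma continuous_on_schoenberg: "continuous_on A schoenberg"
  unfolding schoenberg_def[abs_def] by (intro continuous_intros)

lemma schoenberg_periodic: "schoenberg (t + 2 * real n) = schoenberg t"
proof -
  have "cos (pi * (t + 2 * real n)) = cos (pi * t + 2 * real n * pi)" by (simp add: algebra_simps)
  also have "\<dots> = cos (pi * t)" unfolding cos_add cos_2npi sin_2npi by simp
  finally show ?thesis by (simp add: schoenberg_def)
qed

lemma schoenberg_0: assumes "0 \<le> t" "t \<le> 1/3" shows "schoenberg t = 0"
proof -
  have "pi * t \<le> pi * (1/3)" using assms by (intro mult_left_mono) auto
  then have "cos (pi/3) \<le> cos (pi * t)" using assms by (intro cos_monotone_0_pi_le) auto
  then show ?thesis by (simp add: schoenberg_def cos_60)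
qed

lemma schoenberg_1: assumes "2/3 \<le> t" "t \<le> 1" shows "schoenberg t = 1"
proof -
  have "schoenberg t = max 0 (min 1 (1/2 + cos (pi * (1 - t))))"
    by (simp add: schoenberg_def right_diff_distrib cos_diff)
  moreover have "pi * (1 - t) \<le> pi * (1/3)" using assms by (intro mult_left_mono) auto
  then have "cos (pi/3) \<le> cos (pi * (1 - t))" using assms by (intro cos_monotone_0_pi_le) auto
  ultimately show ?thesis by (simp add: cos_60)
qed

text \<open>t is the sum of the 2 a_m / 3^(m+1). After multiplication by 3^k the digits before the
  k-th form an even integer, which periodicity removes; the remainder lies in [0, 1/3] or [2/3, 1]
  according to a_k.\<close>

lemma schoenberg_digits:
  fixes a :: "nat \<Rightarrow> nat"
  assumes a: "\<And>m. a m \<le> 1"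
  obtains t where "0 \<le> t" "t \<le> 1" "\<And>k. schoenberg (3 ^ k * t) = real (a k)"
proof -
  define f where "f m = 2 * real (a m) * (1/3) ^ Suc m" for m
  have f0: "0 \<le> f m" for m by (simp add: f_def)
  have fle: "f m \<le> 2 * (1/3) ^ Suc m" for m using a[of m] by (simp add: f_def)
  have geo: "(\<lambda>m. 2 * (1/3 :: real) ^ Suc m) sums 1"
    using sums_mult[OF geometric_sums[of "1/3 :: real"], of "2/3"] by (simp add: mult_ac)
  have f_sum: "summable f"
    by (rule summable_comparison_test'[OF sums_summable[OF geo], of 0]) (use f0 fle in auto)
  define t where "t = (\<Sum>m. f m)"
  show ?thesis
  proof (rule that[of t])
    show "0 \<le> t" unfolding t_def by (intro suminf_nonneg f_sum f0)
    have "t \<le> (\<Sum>m. 2 * (1/3 :: real) ^ Suc m)" unfolding t_def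
      by (intro suminf_le fle f_sum sums_summable[OF geo])
    then show "t \<le> 1" using sums_unique[OF geo] by simp
    fix k
    define g where "g m = 2 * real (a (m + k)) * (1/3) ^ Suc m" for m
    have g0: "0 \<le> g m" and gle: "g m \<le> 2 * (1/3) ^ Suc m" for m
      using a[of "m + k"] by (auto simp: g_def)
    have g_sum: "summable g"
      by (rule summable_comparison_test'[OF sums_summable[OF geo], of 0]) (use g0 gle in auto)
    have fg: "3 ^ k * f (m + k) = g m" for m by (simp add: f_def g_def power_add power_divide field_simps)
    have "3 ^ k * t = 3 ^ k * (\<Sum>m. f (m + k)) + 3 ^ k * (\<Sum>m<k. f m)"
      unfolding t_def by (subst suminf_split_initial_segment[OF f_sum, of k]) (simp add: distrib_left)
    also have "3 ^ k * (\<Sum>m. f (m + k)) = (\<Sum>m. g m)"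
      using suminf_mult[of "\<lambda>m. f (m + k)" "3 ^ k"] f_sum by (simp add: fg summable_iff_shift)
    also have "3 ^ k * (\<Sum>m<k. f m) = 2 * real (\<Sum>m<k. a m * 3 ^ (k - Suc m))"
    proof -
      have "3 ^ k * f m = 2 * real (a m * 3 ^ (k - Suc m))" if "m < k" for m
      proof -
        have "(3::real) ^ k = 3 ^ (k - Suc m) * 3 ^ Suc m" using that power_add[of "3::real" "k - Suc m" "Suc m"] by simp
        then show ?thesis by (simp add: f_def power_divide)
      qed
      then show ?thesis by (simp add: sum_distrib_left)
    qed
    finally have "schoenberg (3 ^ k * t) = schoenberg (\<Sum>m. g m)"
      by (simp only: schoenberg_periodic)
    also have "(\<Sum>m. g m) = g 0 + (\<Sum>m. g (Suc m))" using suminf_split_head[OF g_sum] by simp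
    also have "schoenberg (g 0 + (\<Sum>m. g (Suc m))) = real (a k)"
    proof -
      have g_sum': "summable (\<lambda>m. g (Suc m))" using g_sum by (simp add: summable_Suc_iff)
      have geo': "(\<lambda>m. 2 * (1/3 :: real) ^ Suc (Suc m)) sums (1/3)"
        using sums_mult[OF geo, of "1/3"] by (simp add: mult_ac)
      have "0 \<le> (\<Sum>m. g (Suc m))" by (intro suminf_nonneg g_sum' g0)
      moreover have "(\<Sum>m. g (Suc m)) \<le> (\<Sum>m. 2 * (1/3 :: real) ^ Suc (Suc m))"
        by (intro suminf_le gle g_sum' sums_summable[OF geo'])
      then have "(\<Sum>m. g (Suc m)) \<le> 1/3" using sums_unique[OF geo'] by simp
      moreover have "g 0 = 2/3 * real (a k)" by (simp add: g_def)
      moreover have "a k = 0 \<or> a k = 1" using a[of k] by linarith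
      ultimately show ?thesis by (auto intro!: schoenberg_0 schoenberg_1)
    qed
    finally show "schoenberg (3 ^ k * t) = real (a k)" .
  qed
qed

lemma binary_digits:
  assumes "0 \<le> x" "x < (1::real)"
  obtains a :: "nat \<Rightarrow> nat" where "\<And>i. a i \<le> 1" "(\<lambda>i. real (a i) * (1/2) ^ Suc i) sums x"
proof -
  define b where "b i = \<lfloor>2 ^ Suc i * x\<rfloor> mod 2" for i
  have b01: "0 \<le> b i" "b i \<le> 1" for i unfolding b_def by (auto simp: pos_mod_bound[of 2, simplified] zless_add1_eq[symmetric])
  have partial: "(\<Sum>i<n. real (nat (b i)) * (1/2) ^ Suc i) = of_int \<lfloor>2 ^ n * x\<rfloor> / 2 ^ n" for n
  proof (induction n)
    case 0
    have "\<lfloor>x\<rfloor> = 0" using assms by (simp add: floor_eq_iff)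
    then show ?case by simp
  next
    case (Suc n)
    have "\<lfloor>2 ^ Suc n * x\<rfloor> div 2 = \<lfloor>2 ^ n * x\<rfloor>"
      using floor_divide_real_eq_div[of 2 "2 ^ Suc n * x"] by simp
    then have eq: "\<lfloor>2 ^ Suc n * x\<rfloor> = 2 * \<lfloor>2 ^ n * x\<rfloor> + b n"
      unfolding b_def by (metis mult_div_mod_eq)
    have "(\<Sum>i<Suc n. real (nat (b i)) * (1/2) ^ Suc i) = of_int \<lfloor>2 ^ n * x\<rfloor> / 2 ^ n + of_int (b n) * (1/2) ^ Suc n"
      unfolding sum.lessThan_Suc Suc using b01[of n] by simp
    also have "\<dots> = of_int \<lfloor>2 ^ Suc n * x\<rfloor> / 2 ^ Suc n"
      unfolding eq by (simp add: field_simps power_divide)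
    finally show ?case .
  qed
  have "(\<lambda>n. of_int \<lfloor>2 ^ n * x\<rfloor> / 2 ^ n) \<longlonglongrightarrow> x"
  proof (rule real_tendsto_sandwich)
    show "\<forall>\<^sub>F n in sequentially. x - (1/2) ^ n \<le> of_int \<lfloor>2 ^ n * x\<rfloor> / 2 ^ n"
    proof (rule always_eventually, rule allI)
      fix n
      have "2 ^ n * x - 1 \<le> of_int \<lfloor>2 ^ n * x\<rfloor>" by linarith
      then have "(2 ^ n * x - 1) / 2 ^ n \<le> of_int \<lfloor>2 ^ n * x\<rfloor> / 2 ^ n" by (intro divide_right_mono) auto
      then show "x - (1/2) ^ n \<le> of_int \<lfloor>2 ^ n * x\<rfloor> / 2 ^ n" by (simp add: diff_divide_distrib power_divide)
    qed
    show "\<forall>\<^sub>F n in sequentially. of_int \<lfloor>2 ^ n * x\<rfloor> / 2 ^ n \<le> x"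
    proof (rule always_eventually, rule allI)
      fix n
      have "of_int \<lfloor>2 ^ n * x\<rfloor> / 2 ^ n \<le> (2 ^ n * x) / 2 ^ n" by (intro divide_right_mono of_int_floor_le) auto
      then show "of_int \<lfloor>2 ^ n * x\<rfloor> / 2 ^ n \<le> x" by simp
    qed
    have "(\<lambda>n. x - (1/2) ^ n) \<longlonglongrightarrow> x - 0" by (intro tendsto_intros LIMSEQ_power_zero) auto
    then show "(\<lambda>n. x - (1/2) ^ n) \<longlonglongrightarrow> x" by simp
  qed auto
  then have "(\<lambda>i. real (nat (b i)) * (1/2) ^ Suc i) sums x" unfolding sums_def partial .
  moreover have "nat (b i) \<le> 1" for i using b01[of i] by simp
  ultimately show ?thesis using that[of "\<lambda>i. nat (b i)"] by blast
qed

text \<open>The pairing of indices gives each coordinate its own infinite set of ternary digits of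
  t, read as the binary digits of that coordinate. Hence all coordinates can be prescribed
  independently.\<close>

definition curve :: "nat \<Rightarrow> real \<Rightarrow> real" where
  "curve k t = (\<Sum>i. schoenberg (3 ^ prod_encode (k, i) * t) * (1/2) ^ Suc i)"

lemma continuous_on_curve: "continuous_on UNIV (curve k)"
proof (rule uniform_limit_theorem)
  show "uniform_limit UNIV (\<lambda>n t. \<Sum>i<n. schoenberg (3 ^ prod_encode (k, i) * t) * (1/2) ^ Suc i) (curve k) sequentially"
    unfolding curve_def[abs_def]
  proof (rule Weierstrass_m_test)
    show "summable (\<lambda>i. (1/2 :: real) ^ Suc i)"
      using summable_geometric[of "1/2 :: real"] summable_Suc_iff by fastforce
    show "norm (schoenberg (3 ^ prod_encode (k, i) * t) * (1/2) ^ Suc i) \<le> (1/2) ^ Suc i" for i t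
      using schoenberg_bounds by (auto simp: abs_mult)
  qed
  show "\<forall>\<^sub>F n in sequentially. continuous_on UNIV (\<lambda>t. \<Sum>i<n. schoenberg (3 ^ prod_encode (k, i) * t) * (1/2) ^ Suc i)"
    by (intro always_eventually allI continuous_intros continuous_on_compose2[OF continuous_on_schoenberg[of UNIV]]) auto
qed auto

lemma curve_surj:
  assumes "\<And>k. 0 \<le> x k" "\<And>k. x k < 1"
  obtains t where "0 \<le> t" "t \<le> 1" "\<And>k. curve k t = x k"
proof -
  have "\<exists>a :: nat \<Rightarrow> nat. (\<forall>i. a i \<le> 1) \<and> (\<lambda>i. real (a i) * (1/2) ^ Suc i) sums x k" for k
    using binary_digits[OF assms[of k]] by metis
  then obtain a :: "nat \<Rightarrow> nat \<Rightarrow> nat" where a: "\<And>k i. a k i \<le> 1" "\<And>k. (\<lambda>i. real (a k i) * (1/2) ^ Suc i) sums x k"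
    by metis
  obtain t where t: "0 \<le> t" "t \<le> 1"
    "\<And>m. schoenberg (3 ^ m * t) = real (case prod_decode m of (k, i) \<Rightarrow> a k i)"
    by (rule schoenberg_digits[of "\<lambda>m. case prod_decode m of (k, i) \<Rightarrow> a k i"]) (use a(1) in \<open>auto split: prod.splits\<close>)
  have "curve k t = x k" for k
    unfolding curve_def t(3) using sums_unique[OF a(2)[of k]] by simp
  then show ?thesis using that t by blast
qed

definition disc_retract :: "complex \<Rightarrow> complex" where
  "disc_retract w = w / complex_of_real (max 1 (cmod w))"

text \<open>The affine map sends [0, 1] onto [-2, 2], so points of the disc come from coordinates in
  [1/4, 3/4], away from the value 1 that \<open>curve_surj\<close> excludes. The retraction fixes
  the disc and brings all other parameters into it.\<close>

definition disc_curve :: "nat \<Rightarrow> real \<Rightarrow> complex" where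
  "disc_curve k t = disc_retract (Complex (4 * curve (2 * k) t - 2) (4 * curve (2 * k + 1) t - 2))"

lemma cmod_disc_curve_le: "cmod (disc_curve k t) \<le> 1"
  by (simp add: disc_curve_def disc_retract_def norm_divide divide_le_eq)

lemma continuous_on_disc_curve: "continuous_on UNIV (disc_curve k)"
proof -
  have "continuous_on UNIV disc_retract"
    unfolding disc_retract_def[abs_def] by (intro continuous_intros) (auto simp: max_def)
  moreover have "continuous_on UNIV (\<lambda>t. Complex (4 * curve (2 * k) t - 2) (4 * curve (2 * k + 1) t - 2))"
    unfolding Complex_eq by (intro continuous_intros continuous_on_curve)
  ultimately show ?thesis
    unfolding disc_curve_def[abs_def] by (rule continuous_on_compose2) auto
qed

lemma disc_curve_surj:
  assumes w: "\<And>k. cmod (w k) \<le> 1"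
  obtains t where "0 \<le> t" "t \<le> 1" "\<And>k. disc_curve k t = w k"
proof -
  define x where "x m = ((if even m then Re (w (m div 2)) else Im (w (m div 2))) + 2) / 4" for m
  have "\<bar>Re (w k)\<bar> \<le> 1" "\<bar>Im (w k)\<bar> \<le> 1" for k
    using w[of k] abs_Re_le_cmod[of "w k"] abs_Im_le_cmod[of "w k"] by linarith+
  then have re: "-1 \<le> Re (w k)" "Re (w k) \<le> 1" "-1 \<le> Im (w k)" "Im (w k) \<le> 1" for k
    by (auto simp: abs_le_iff minus_le_iff)
  have "0 \<le> x m" "x m < 1" for m using re[of "m div 2"] by (auto simp: x_def)
  then obtain t where t: "0 \<le> t" "t \<le> 1" "\<And>k. curve k t = x k"
    using curve_surj[of x] by metis
  have "disc_curve k t = w k" for k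
  proof -
    have "Complex (4 * curve (2 * k) t - 2) (4 * curve (2 * k + 1) t - 2) = w k"
      by (simp add: t(3) x_def complex_eq_iff field_simps)
    then show ?thesis unfolding disc_curve_def disc_retract_def using w[of k] by (simp add: max_absorb1)
  qed
  then show ?thesis using that t by blast
qed

section \<open>Passage to the limit\<close>

definition empirical :: "nat \<Rightarrow> (nat \<Rightarrow> real) \<Rightarrow> real measure" where
  "empirical N xs = distr (uniform_count_measure {..<N}) borel xs"

lemma real_distribution_empirical:
  assumes "0 < N"
  shows "real_distribution (empirical N xs)"
proof -
  interpret prob_space "uniform_count_measure {..<N}"
    using assms by (intro prob_space_uniform_count_measure) auto
  show ?thesis unfolding empirical_def by (rule real_distribution_distr) (simp add: uniform_count_measure_def)
qed

lemma integral_empirical: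
  fixes f :: "real \<Rightarrow> 'b::{banach, second_countable_topology}"
  assumes "f \<in> borel_measurable borel"
  shows "(\<integral>t. f t \<partial>empirical N xs) = (1 / real N) *\<^sub>R (\<Sum>m<N. f (xs m))"
  unfolding empirical_def using assms
  by (subst integral_distr)
    (auto simp: uniform_count_measure_def lebesgue_integral_point_measure_finite scaleR_sum_right)

lemma measure_empirical_eq_1:
  assumes "0 < N" "A \<in> sets borel" "\<And>m. m < N \<Longrightarrow> xs m \<in> A"
  shows "measure (empirical N xs) A = 1"
proof -
  have "xs -` A \<inter> {..<N} = {..<N}" using assms(3) by auto
  then show ?thesis unfolding empirical_def using assms
    by (subst measure_distr) (auto simp: uniform_count_measure_def[symmetric] space_uniform_count_measure
        measure_uniform_count_measure_if sets_uniform_count_measure measurable_def)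
qed

section \<open>Homogeneous coordinates on the curve\<close>

locale bounded_multiplier =
  fixes P R d C :: real and c :: cmatrix
  assumes adm: "admissible P" "admissible R" and d: "d = 1 - 1/P - 1/R" "0 \<le> d" and C: "0 \<le> C"
    and c: "multiplier_bound P R c C"
begin

text \<open>The largest modulus s compatible with
  \<open>(1/2) ^ Suc j * modular Q s \<le> 1\<close>, and 1 for Q = 0; see \<open>le_radius\<close>.
  It is independent of the length of the section, so one bounded region serves every n.\<close>

definition radius :: "real \<Rightarrow> nat \<Rightarrow> real" where
  "radius Q j = 2 powr (real (Suc j) / Q)"

text \<open>Coordinate 0 of the curve is reserved for \<open>H\<close>, the odd ones for
  \<open>X\<close>, the positive even ones for \<open>Y\<close>.\<close>

definition X :: "nat \<Rightarrow> real \<Rightarrow> complex" where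
  "X j t = complex_of_real (radius P j) * disc_curve (2 * j + 1) t"

definition Y :: "nat \<Rightarrow> real \<Rightarrow> complex" where
  "Y i t = complex_of_real (radius R i) * disc_curve (2 * i + 2) t"

definition H :: "real \<Rightarrow> real" where
  "H t = cmod (disc_curve 0 t)"

text \<open>The density of the final measure up to normalisation. For \<open>d = 0\<close> points
  with \<open>H t = 0\<close> still contribute to the pairings, whereas \<open>0 powr 0 = 0\<close>
  would drop them; hence the constant 1.\<close>

definition G :: "real \<Rightarrow> real" where
  "G t = (if d = 0 then 1 else H t)"

text \<open>At a point with H = h, X_j = h^(1/P) v_j and Y_i = h^(1/R) u_i, where h > 0, this equals
  h (C v_j u_i - c_ij).\<close>

definition discrepancy :: "nat \<Rightarrow> nat \<Rightarrow> real \<Rightarrow> complex" where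
  "discrepancy i j t = complex_of_real C * (X j t * Y i t) * complex_of_real (G t powr d) - c i j * complex_of_real (H t)"

lemma radius_pos: "0 < radius Q j"
  by (simp add: radius_def)

lemma cmod_X_le: "cmod (X j t) \<le> radius P j" and cmod_Y_le: "cmod (Y j t) \<le> radius R j"
  using cmod_disc_curve_le radius_pos[THEN less_imp_le]
  by (auto simp: X_def Y_def norm_mult abs_of_pos radius_pos intro: mult_left_le)

lemma H_bounds: "0 \<le> H t" "H t \<le> 1"
  by (auto simp: H_def cmod_disc_curve_le)

lemma G_bounds: "0 \<le> G t" "G t \<le> 1"
  by (auto simp: G_def H_bounds)

lemma continuous_X: "continuous_on A (X j)" and continuous_Y: "continuous_on A (Y j)" and continuous_H: "continuous_on A H"
  using continuous_on_subset[OF continuous_on_disc_curve subset_UNIV]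
  unfolding X_def[abs_def] Y_def[abs_def] H_def[abs_def] by (auto intro!: continuous_intros)

lemma continuous_modular:
  assumes "admissible Q" "continuous_on A f"
  shows "continuous_on A (\<lambda>t. modular Q (cmod (f t)))"
proof (cases "Q = 0")
  case False
  then have "continuous_on A (\<lambda>t. cmod (f t) powr Q)"
    using assms by (intro continuous_on_powr' continuous_on_norm continuous_on_const) (auto simp: admissible_def)
  then show ?thesis using False by (simp add: modular_def)
qed (simp add: modular_def)

lemma continuous_discrepancy: "continuous_on A (discrepancy i j)"
proof -
  have G: "continuous_on A (\<lambda>t. G t powr d)"
  proof (cases "d = 0")
    case False
    then have "0 < d" using d(2) by simp
    then have "continuous_on A (\<lambda>t. H t powr d)"
      using H_bounds(1) by (intro continuous_on_powr' continuous_H continuous_on_const) auto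
    then show ?thesis using False by (simp add: G_def)
  next
    case True
    then have "G t powr d = 1" for t unfolding G_def by simp
    then show ?thesis by simp
  qed
  then show ?thesis unfolding discrepancy_def[abs_def]
    by (intro continuous_on_diff continuous_on_mult continuous_on_const continuous_on_of_real
        G continuous_X continuous_Y continuous_H)
qed

lemma cmod_discrepancy_le: "cmod (discrepancy i j t) \<le> C * (radius P j * radius R i) + cmod (c i j)"
proof -
  have G1: "G t powr d \<le> 1" using G_bounds d by (intro powr_le1) auto
  have "cmod (discrepancy i j t) \<le> C * (cmod (X j t) * cmod (Y i t)) * G t powr d + cmod (c i j) * H t"
    unfolding discrepancy_def using C H_bounds by (intro order_trans[OF norm_triangle_ineq4]) (simp add: norm_mult)
  also have "\<dots> \<le> C * (radius P j * radius R i) * 1 + cmod (c i j) * 1"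
    using C H_bounds radius_pos[THEN less_imp_le] G1
    by (intro add_mono mult_mono mult_nonneg_nonneg cmod_X_le cmod_Y_le) auto
  finally show ?thesis by simp
qed

lemma modular_mono: "admissible Q \<Longrightarrow> 0 \<le> s \<Longrightarrow> s \<le> t \<Longrightarrow> modular Q s \<le> modular Q t"
  by (auto simp: modular_def admissible_def intro: powr_mono2)

lemma modular_powr_inverse:
  "admissible Q \<Longrightarrow> 0 < h \<Longrightarrow> 0 \<le> s \<Longrightarrow> modular Q (h powr (1/Q) * s) = h * modular Q s"
  by (auto simp: modular_def admissible_def powr_mult powr_powr)

lemma le_radius:
  assumes Q: "admissible Q" and s: "0 \<le> s" "Q = 0 \<longrightarrow> s \<le> 1" and le: "(1/2) ^ Suc j * modular Q s \<le> 1"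
  shows "s \<le> radius Q j"
proof (cases "Q = 0")
  case False
  then have Q1: "1 \<le> Q" using Q by (auto simp: admissible_def)
  have "s powr Q \<le> 2 ^ Suc j" using le False by (simp add: modular_def power_divide divide_le_eq)
  then have "(s powr Q) powr (1/Q) \<le> (2 ^ Suc j) powr (1/Q)" using Q1 by (intro powr_mono2) auto
  also have "(2 ^ Suc j :: real) powr (1/Q) = radius Q j"
    unfolding radius_def by (subst powr_realpow[symmetric]) (auto simp: powr_powr)
  finally show ?thesis using s Q1 by (simp add: powr_powr)
qed (use s in \<open>simp add: radius_def\<close>)

text \<open>The weights sum to at most 1. So if no modular has a larger mean than \<open>H\<close>,
  the mean of \<open>H\<close> is at least 1/3 on these points, which rules out a limit concentrated
  on H = 0.\<close>

definition simplex_points :: "nat \<Rightarrow> real set" where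
  "simplex_points n = {t \<in> {0..1}. H t + (\<Sum>j<n. (1/2) ^ Suc j * modular P (cmod (X j t)))
     + (\<Sum>i<n. (1/2) ^ Suc i * modular R (cmod (Y i t))) = 1}"

text \<open>
  The point \<open>t\<close> encodes the vectors \<open>v\<close>, \<open>u\<close> homogenised by the factor \<open>H t = 1/D\<close>;
  all constraints are homogeneous of degree one in this factor.
\<close>

lemma homogenised_dual_step:
  assumes n: "0 < n" and s: "\<And>k. 0 \<le> s k"
  shows "\<exists>t\<in>simplex_points n.
    Re (\<Sum>(i,j)\<in>{..<n} \<times> {..<n}. b (i,j) * discrepancy i j t)
      + (\<Sum>k\<in>{..<n} <+> {..<n}. s k * (case k of Inl j \<Rightarrow> modular P (cmod (X j t)) - H t
                                             | Inr i \<Rightarrow> modular R (cmod (Y i t)) - H t)) \<le> 1"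
proof -
  obtain v u where vu: "P = 0 \<longrightarrow> (\<forall>j. cmod (v j) \<le> 1)" "R = 0 \<longrightarrow> (\<forall>i. cmod (u i) \<le> 1)"
    "\<And>j. n \<le> j \<Longrightarrow> v j = 0" "\<And>i. n \<le> i \<Longrightarrow> u i = 0"
    and val: "Re (\<Sum>i<n. \<Sum>j<n. b (i,j) * (complex_of_real C * (v j * u i) - c i j))
      + (\<Sum>j<n. s (Inl j) * (modular P (cmod (v j)) - 1)) + (\<Sum>i<n. s (Inr i) * (modular R (cmod (u i)) - 1)) \<le> 1"
    by (rule multiplier_bound_dual_step[OF adm C c n, where s = "\<lambda>j. s (Inl j)" and t = "\<lambda>i. s (Inr i)"
        and b = "\<lambda>i j. b (i,j)"]) (use s in auto)
  define SP where "SP = (\<Sum>j<n. (1/2) ^ Suc j * modular P (cmod (v j)))"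
  define SR where "SR = (\<Sum>i<n. (1/2) ^ Suc i * modular R (cmod (u i)))"
  \<comment> \<open>The factor that puts the homogenised point into
    \<open>simplex_points n\<close>.\<close>
  define h where "h = 1 / (1 + SP + SR)"
  have SP0: "0 \<le> SP" and SR0: "0 \<le> SR"
    by (auto simp: SP_def SR_def intro!: sum_nonneg mult_nonneg_nonneg modular_nonneg)
  have h: "0 < h" "h \<le> 1" "h + h * SP + h * SR = 1"
    using SP0 SR0 by (auto simp: h_def divide_simps)
  have hSP: "h * SP \<le> 1" "h * SR \<le> 1" using h SP0 SR0 by (smt (verit) mult_nonneg_nonneg)+
  define x where "x j = complex_of_real (h powr (1/P)) * v j" for j
  define y where "y i = complex_of_real (h powr (1/R)) * u i" for i
  have cx: "cmod (x j) = h powr (1/P) * cmod (v j)" and cy: "cmod (y j) = h powr (1/R) * cmod (u j)" for j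
    by (auto simp: x_def y_def norm_mult)
  have mx: "modular P (cmod (x j)) = h * modular P (cmod (v j))" for j
    unfolding cx using adm h by (intro modular_powr_inverse) auto
  have my: "modular R (cmod (y j)) = h * modular R (cmod (u j))" for j
    unfolding cy using adm h by (intro modular_powr_inverse) auto
  have xr: "cmod (x j) \<le> radius P j" for j
  proof (cases "j < n")
    case True
    have "(1/2) ^ Suc j * modular P (cmod (x j)) = h * ((1/2) ^ Suc j * modular P (cmod (v j)))"
      by (simp add: mx)
    also have "\<dots> \<le> h * SP" unfolding SP_def using h True
      by (intro mult_left_mono member_le_sum) (auto intro!: modular_nonneg mult_nonneg_nonneg)
    finally show ?thesis using hSP vu(1) h(1) by (intro le_radius adm) (auto simp: cx)
  next
    case False
    then show ?thesis using vu(3)[of j] radius_pos[of P j] by (simp add: x_def)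
  qed
  have yr: "cmod (y j) \<le> radius R j" for j
  proof (cases "j < n")
    case True
    have "(1/2) ^ Suc j * modular R (cmod (y j)) = h * ((1/2) ^ Suc j * modular R (cmod (u j)))"
      by (simp add: my)
    also have "\<dots> \<le> h * SR" unfolding SR_def using h True
      by (intro mult_left_mono member_le_sum) (auto intro!: modular_nonneg mult_nonneg_nonneg)
    finally show ?thesis using hSP vu(2) h(1) by (intro le_radius adm) (auto simp: cy)
  next
    case False
    then show ?thesis using vu(4)[of j] radius_pos[of R j] by (simp add: y_def)
  qed
  define w where "w k = (if k = 0 then complex_of_real h
      else if odd k then x (k div 2) / complex_of_real (radius P (k div 2))
      else y (k div 2 - 1) / complex_of_real (radius R (k div 2 - 1)))" for k
  have "cmod (w k) \<le> 1" for k
    using h xr yr radius_pos by (auto simp: w_def norm_divide divide_le_eq abs_of_pos)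
  then obtain t where t: "0 \<le> t" "t \<le> 1" "\<And>k. disc_curve k t = w k"
    using disc_curve_surj[of w] by metis
  have Ht: "H t = h" using h by (simp add: H_def t w_def)
  have Xt: "X j t = x j" for j
    using radius_pos[of P j] by (simp add: X_def t w_def)
  have Yt: "Y j t = y j" for j
    using radius_pos[of R j] by (simp add: Y_def t w_def)
  have Gt: "G t powr d = h powr d" using h by (simp add: G_def Ht)
  have "h powr (1/P) * h powr (1/R) * h powr d = h powr (1/P + 1/R + d)"
    by (simp add: powr_add)
  also have "1/P + 1/R + d = 1" using d by simp
  finally have hpow: "h powr (1/P) * h powr (1/R) * h powr d = h" using h by simp
  have disc: "discrepancy i j t = complex_of_real h * (complex_of_real C * (v j * u i) - c i j)" for i j
  proof -
    have "discrepancy i j t = complex_of_real (h powr (1/P) * h powr (1/R) * h powr d) * (complex_of_real C * (v j * u i))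
        - c i j * complex_of_real h"
      unfolding discrepancy_def Xt Yt Gt Ht x_def y_def by (simp add: mult_ac)
    then show ?thesis unfolding hpow by (simp add: algebra_simps)
  qed
  have "t \<in> simplex_points n"
  proof -
    have "(\<Sum>j<n. (1/2) ^ Suc j * modular P (cmod (X j t))) = h * SP"
      unfolding Xt mx SP_def sum_distrib_left by (intro sum.cong) auto
    moreover have "(\<Sum>j<n. (1/2) ^ Suc j * modular R (cmod (Y j t))) = h * SR"
      unfolding Yt my SR_def sum_distrib_left by (intro sum.cong) auto
    ultimately show ?thesis using t h by (simp add: simplex_points_def Ht)
  qed
  moreover have "Re (\<Sum>(i,j)\<in>{..<n} \<times> {..<n}. b (i,j) * discrepancy i j t)
      + (\<Sum>k\<in>{..<n} <+> {..<n}. s k * (case k of Inl j \<Rightarrow> modular P (cmod (X j t)) - H t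
                                             | Inr i \<Rightarrow> modular R (cmod (Y i t)) - H t)) \<le> 1"
  proof -
    have "(\<Sum>(i,j)\<in>{..<n} \<times> {..<n}. b (i,j) * discrepancy i j t)
      = complex_of_real h * (\<Sum>i<n. \<Sum>j<n. b (i,j) * (complex_of_real C * (v j * u i) - c i j))"
      unfolding sum.cartesian_product[symmetric] disc sum_distrib_left by (intro sum.cong refl) (simp add: mult_ac)
    moreover have "(\<Sum>k\<in>{..<n} <+> {..<n}. s k * (case k of Inl j \<Rightarrow> modular P (cmod (X j t)) - H t
                                             | Inr i \<Rightarrow> modular R (cmod (Y i t)) - H t))
      = h * (\<Sum>j<n. s (Inl j) * (modular P (cmod (v j)) - 1)) + h * (\<Sum>i<n. s (Inr i) * (modular R (cmod (u i)) - 1))"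
      by (simp add: sum.Plus Xt Yt Ht mx my sum_distrib_left algebra_simps)
    ultimately have "Re (\<Sum>(i,j)\<in>{..<n} \<times> {..<n}. b (i,j) * discrepancy i j t)
      + (\<Sum>k\<in>{..<n} <+> {..<n}. s k * (case k of Inl j \<Rightarrow> modular P (cmod (X j t)) - H t
                                             | Inr i \<Rightarrow> modular R (cmod (Y i t)) - H t))
      = h * (Re (\<Sum>i<n. \<Sum>j<n. b (i,j) * (complex_of_real C * (v j * u i) - c i j))
      + (\<Sum>j<n. s (Inl j) * (modular P (cmod (v j)) - 1)) + (\<Sum>i<n. s (Inr i) * (modular R (cmod (u i)) - 1)))"
      by (simp add: distrib_left add.assoc)
    \<comment> \<open>As \<open>h \<le> 1\<close>, the bound 1 survives the homogenisation.\<close>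
    also have "\<dots> \<le> h * 1" using val h by (intro mult_left_mono) auto
    finally show ?thesis using h by simp
  qed
  ultimately show ?thesis by blast
qed

lemma continuous_X_gap: "continuous_on A (\<lambda>t. modular P (cmod (X j t)) - H t)"
  by (intro continuous_on_diff continuous_modular adm(1) continuous_X continuous_H)

lemma continuous_Y_gap: "continuous_on A (\<lambda>t. modular R (cmod (Y i t)) - H t)"
  by (intro continuous_on_diff continuous_modular adm(2) continuous_Y continuous_H)

text \<open>The bound D on the squared constraints depends on n, but the error of the average over N
  points is at most the square root of (D + 2)/N, and N is chosen after D.\<close>

lemma finite_stage:
  assumes n: "0 < n"
  obtains \<rho> where "real_distribution \<rho>" "measure \<rho> {-1<..1} = 1"
    "\<forall>i<n. \<forall>j<n. cmod (\<integral>t. discrepancy i j t \<partial>\<rho>) \<le> 1 / real n"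
    "\<forall>j<n. (\<integral>t. modular P (cmod (X j t)) - H t \<partial>\<rho>) \<le> 1 / real n"
    "\<forall>i<n. (\<integral>t. modular R (cmod (Y i t)) - H t \<partial>\<rho>) \<le> 1 / real n"
    "(1 - 2 / real n) / 3 \<le> (\<integral>t. H t \<partial>\<rho>)"
proof -
  define A where "A = {..<n} \<times> {..<n}"
  define B where "B = ({..<n} <+> {..<n} :: (nat + nat) set)"
  define f where "f t ij = discrepancy (fst ij) (snd ij) t" for t ij
  define g where "g t k = (case k of Inl j \<Rightarrow> modular P (cmod (X j t)) - H t
                                   | Inr i \<Rightarrow> modular R (cmod (Y i t)) - H t)" for t k
  have cf: "continuous_on {0..1} (\<lambda>t. f t ij)" for ij unfolding f_def by (rule continuous_discrepancy)
  have cg: "continuous_on {0..1} (\<lambda>t. g t k)" for k unfolding g_def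
    by (cases k) (auto intro: continuous_X_gap continuous_Y_gap)
  define S where "S t = (\<Sum>ij\<in>A. (cmod (f t ij))\<^sup>2) + (\<Sum>k\<in>B. (g t k)\<^sup>2)" for t
  have "continuous_on {0..1} S" unfolding S_def[abs_def] by (intro continuous_intros cf cg)
  then have "compact (S ` {0..1})" by (rule compact_continuous_image) simp
  then have "bdd_above (S ` {0..1})" by (intro bounded_imp_bdd_above compact_imp_bounded)
  then obtain D where D: "\<And>t. t \<in> {0..1} \<Longrightarrow> S t \<le> D" unfolding bdd_above_def by blast
  \<comment> \<open>Makes N (D + 2) at most (N/n)^2, so each constraint fails by at most 1/n on
    average.\<close>
  obtain N :: nat where N: "0 < N" "(D + 2) * (real n)\<^sup>2 \<le> real N"
  proof -
    obtain N0 :: nat where "(D + 2) * (real n)\<^sup>2 \<le> real N0" using real_arch_simple by blast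
    then show ?thesis by (intro that[of "Suc N0"]) linarith+
  qed
  have "\<exists>xs. (\<forall>m<N. xs m \<in> simplex_points n) \<and>
    (\<Sum>ij\<in>A. (cmod (\<Sum>m<N. f (xs m) ij))\<^sup>2) + (\<Sum>k\<in>B. (max 0 (\<Sum>m<N. g (xs m) k))\<^sup>2) \<le> real N * (D + 2)"
  proof (rule approachability)
    show "(\<Sum>ij\<in>A. (cmod (f t ij))\<^sup>2) + (\<Sum>k\<in>B. (g t k)\<^sup>2) \<le> D" if "t \<in> simplex_points n" for t
      using D[of t] that by (simp add: simplex_points_def S_def)
    show "\<exists>t\<in>simplex_points n. Re (\<Sum>ij\<in>A. b ij * f t ij) + (\<Sum>k\<in>B. s k * g t k) \<le> 1"
      if "\<And>k. 0 \<le> s k" for b s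
      using homogenised_dual_step[OF n that, of b] by (simp add: A_def B_def f_def g_def split_def)
  qed
  then obtain xs where xs: "\<And>m. m < N \<Longrightarrow> xs m \<in> simplex_points n"
    and le: "(\<Sum>ij\<in>A. (cmod (\<Sum>m<N. f (xs m) ij))\<^sup>2) + (\<Sum>k\<in>B. (max 0 (\<Sum>m<N. g (xs m) k))\<^sup>2) \<le> real N * (D + 2)"
    by blast
  have nonneg: "0 \<le> (\<Sum>ij\<in>A. (cmod (\<Sum>m<N. f (xs m) ij))\<^sup>2)" "0 \<le> (\<Sum>k\<in>B. (max 0 (\<Sum>m<N. g (xs m) k))\<^sup>2)"
    by (intro sum_nonneg zero_le_power2)+
  have "real N * (D + 2) * (real n)\<^sup>2 \<le> real N * real N"
    using mult_left_mono[OF N(2), of "real N"] by (simp add: mult.assoc)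
  then have le': "real N * (D + 2) \<le> (real N / real n)\<^sup>2"
    using n by (simp add: power_divide power2_eq_square[of "real N"] pos_le_divide_eq)
  have fle: "cmod (\<Sum>m<N. f (xs m) ij) \<le> real N / real n" if "ij \<in> A" for ij
  proof (rule power2_le_imp_le)
    have "(cmod (\<Sum>m<N. f (xs m) ij))\<^sup>2 \<le> (\<Sum>ij\<in>A. (cmod (\<Sum>m<N. f (xs m) ij))\<^sup>2)"
      by (intro member_le_sum that zero_le_power2) (simp add: A_def)
    also have "\<dots> \<le> real N * (D + 2)" using le nonneg by linarith
    finally show "(cmod (\<Sum>m<N. f (xs m) ij))\<^sup>2 \<le> (real N / real n)\<^sup>2" using le' by (rule order_trans)
  qed simp
  have gle: "(\<Sum>m<N. g (xs m) k) \<le> real N / real n" if "k \<in> B" for k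
  proof -
    have "max 0 (\<Sum>m<N. g (xs m) k) \<le> real N / real n"
    proof (rule power2_le_imp_le)
      have "(max 0 (\<Sum>m<N. g (xs m) k))\<^sup>2 \<le> (\<Sum>k\<in>B. (max 0 (\<Sum>m<N. g (xs m) k))\<^sup>2)"
        by (intro member_le_sum that zero_le_power2) (simp add: B_def)
      also have "\<dots> \<le> real N * (D + 2)" using le nonneg by linarith
      finally show "(max 0 (\<Sum>m<N. g (xs m) k))\<^sup>2 \<le> (real N / real n)\<^sup>2" using le' by (rule order_trans)
    qed simp
    then show ?thesis by simp
  qed
  have inB: "Inl j \<in> B" "Inr j \<in> B" if "j < n" for j using that by (auto simp: B_def)
  have avg: "(1 / real N) * z \<le> 1 / real n" if "z \<le> real N / real n" for z
    using mult_left_mono[OF that, of "1 / real N"] N(1) by simp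
  have meas: "h \<in> borel_measurable borel" if "continuous_on UNIV h" for h :: "real \<Rightarrow> 'b::real_normed_vector"
    using that by (rule borel_measurable_continuous_onI)
  define \<rho> where "\<rho> = empirical N xs"
  define h where "h = (\<Sum>m<N. H (xs m))"
  have weights: "(\<Sum>j<n. (1/2 :: real) ^ Suc j) \<le> 1"
  proof -
    have "(\<Sum>j<n. (1/2 :: real) ^ Suc j) = 1 - (1/2) ^ n" by (induction n) auto
    then show ?thesis by simp
  qed
  have h0: "0 \<le> h" unfolding h_def by (intro sum_nonneg H_bounds)
  have sumP: "(\<Sum>m<N. modular P (cmod (X j (xs m)))) \<le> h + real N / real n" if "j < n" for j
    using gle[OF inB(1)[OF that]] by (simp add: g_def sum_subtractf h_def)
  have sumR: "(\<Sum>m<N. modular R (cmod (Y j (xs m)))) \<le> h + real N / real n" if "j < n" for j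
    using gle[OF inB(2)[OF that]] by (simp add: g_def sum_subtractf h_def)
  have "H (xs m) + (\<Sum>j<n. (1/2) ^ Suc j * modular P (cmod (X j (xs m))))
     + (\<Sum>i<n. (1/2) ^ Suc i * modular R (cmod (Y i (xs m)))) = 1" if "m < N" for m
    using xs[OF that] unfolding simplex_points_def by blast
  then have "real N = (\<Sum>m<N. H (xs m) + (\<Sum>j<n. (1/2) ^ Suc j * modular P (cmod (X j (xs m))))
     + (\<Sum>i<n. (1/2) ^ Suc i * modular R (cmod (Y i (xs m)))))"
    by (simp del: power_Suc)
  also have "\<dots> = h + (\<Sum>j<n. (1/2) ^ Suc j * (\<Sum>m<N. modular P (cmod (X j (xs m)))))
     + (\<Sum>i<n. (1/2) ^ Suc i * (\<Sum>m<N. modular R (cmod (Y i (xs m)))))"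
    unfolding h_def sum.distrib sum_distrib_left by (simp only: sum.swap[of _ "{..<n}" "{..<N}"])
  \<comment> \<open>The approximate constraints bound every sum of modulars by that of
    \<open>H\<close> plus N/n; together with \<open>h\<close> itself this produces 3h.\<close>
  also have "\<dots> \<le> h + (\<Sum>j<n. (1/2) ^ Suc j * (h + real N / real n)) + (\<Sum>i<n. (1/2) ^ Suc i * (h + real N / real n))"
    by (intro add_mono order_refl sum_mono mult_left_mono sumP sumR) auto
  also have "\<dots> \<le> h + 1 * (h + real N / real n) + 1 * (h + real N / real n)"
    unfolding sum_distrib_right[symmetric] using weights h0 by (intro add_mono order_refl mult_right_mono) auto
  finally have hN: "real N \<le> 3 * h + 2 * (real N / real n)" by simp
  show ?thesis
  proof (rule that[of \<rho>])
    show "real_distribution \<rho>" unfolding \<rho>_def by (rule real_distribution_empirical[OF N(1)])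
    \<comment> \<open>All points lie in [0, 1]; the half-open interval has the shape that
      \<open>tight\<close> asks for.\<close>
    show "measure \<rho> {-1<..1} = 1" unfolding \<rho>_def
      using xs N(1) by (intro measure_empirical_eq_1) (force simp: simplex_points_def)+
    show "\<forall>i<n. \<forall>j<n. cmod (\<integral>t. discrepancy i j t \<partial>\<rho>) \<le> 1 / real n"
    proof (intro allI impI)
      fix i j assume ij: "i < n" "j < n"
      have "(\<integral>t. discrepancy i j t \<partial>\<rho>) = (1 / real N) *\<^sub>R (\<Sum>m<N. f (xs m) (i, j))"
        unfolding \<rho>_def f_def fst_conv snd_conv by (intro integral_empirical meas continuous_discrepancy)
      then show "cmod (\<integral>t. discrepancy i j t \<partial>\<rho>) \<le> 1 / real n"
        using avg[OF fle[of "(i, j)"]] ij by (simp add: A_def)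
    qed
    show "\<forall>j<n. (\<integral>t. modular P (cmod (X j t)) - H t \<partial>\<rho>) \<le> 1 / real n"
    proof (intro allI impI)
      fix j assume j: "j < n"
      have "(\<integral>t. modular P (cmod (X j t)) - H t \<partial>\<rho>) = (1 / real N) *\<^sub>R (\<Sum>m<N. g (xs m) (Inl j))"
        unfolding \<rho>_def g_def sum.case
        by (intro integral_empirical meas continuous_X_gap)
      then show "(\<integral>t. modular P (cmod (X j t)) - H t \<partial>\<rho>) \<le> 1 / real n"
        using avg[OF gle[OF inB(1)[OF j]]] by simp
    qed
    show "\<forall>j<n. (\<integral>t. modular R (cmod (Y j t)) - H t \<partial>\<rho>) \<le> 1 / real n"
    proof (intro allI impI)
      fix j assume j: "j < n"
      have "(\<integral>t. modular R (cmod (Y j t)) - H t \<partial>\<rho>) = (1 / real N) *\<^sub>R (\<Sum>m<N. g (xs m) (Inr j))"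
        unfolding \<rho>_def g_def sum.case
        by (intro integral_empirical meas continuous_Y_gap)
      then show "(\<integral>t. modular R (cmod (Y j t)) - H t \<partial>\<rho>) \<le> 1 / real n"
        using avg[OF gle[OF inB(2)[OF j]]] by simp
    qed
    have "(\<integral>t. H t \<partial>\<rho>) = h / real N"
      unfolding \<rho>_def h_def by (subst integral_empirical) (auto intro: meas continuous_H)
    moreover have "real N * (1 - 2 / real n) \<le> 3 * h" using hN by (simp add: algebra_simps)
    then have "(1 - 2 / real n) / 3 \<le> h / real N" using N(1) by (simp add: field_simps)
    ultimately show "(1 - 2 / real n) / 3 \<le> (\<integral>t. H t \<partial>\<rho>)" by simp
  qed
qed

lemma integrable_bounded_continuous:
  fixes f :: "real \<Rightarrow> 'b::{banach, second_countable_topology}"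
  assumes "real_distribution \<rho>" "continuous_on UNIV f" "\<And>t. norm (f t) \<le> K"
  shows "integrable \<rho> f"
proof -
  interpret real_distribution \<rho> by fact
  have "f \<in> borel_measurable borel" using assms(2) by (rule borel_measurable_continuous_onI)
  then show ?thesis using assms(3) by (intro integrable_const_bound[of _ K]) auto
qed

lemma modular_X_le: "modular P (cmod (X j t)) \<le> modular P (radius P j)"
  and modular_Y_le: "modular R (cmod (Y j t)) \<le> modular R (radius R j)"
  by (intro modular_mono adm cmod_X_le cmod_Y_le norm_ge_zero)+

text \<open>For fixed i and j the integrands are continuous with bounds independent of the stage, so
  the constraints pass to a weak limit; the lower bound for the mean of \<open>H\<close> tends to
  1/3.\<close>

lemma limit_measure:
  obtains \<rho> where "real_distribution \<rho>" "\<forall>i j. (\<integral>t. discrepancy i j t \<partial>\<rho>) = 0"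
    "\<forall>j. (\<integral>t. modular P (cmod (X j t)) \<partial>\<rho>) \<le> (\<integral>t. H t \<partial>\<rho>)"
    "\<forall>i. (\<integral>t. modular R (cmod (Y i t)) \<partial>\<rho>) \<le> (\<integral>t. H t \<partial>\<rho>)"
    "0 < (\<integral>t. H t \<partial>\<rho>)"
proof -
  define stage where "stage n \<rho> \<longleftrightarrow> real_distribution \<rho> \<and> measure \<rho> {-1<..1} = 1 \<and>
    (\<forall>i<n. \<forall>j<n. cmod (\<integral>t. discrepancy i j t \<partial>\<rho>) \<le> 1 / real n) \<and>
    (\<forall>j<n. (\<integral>t. modular P (cmod (X j t)) - H t \<partial>\<rho>) \<le> 1 / real n) \<and>
    (\<forall>i<n. (\<integral>t. modular R (cmod (Y i t)) - H t \<partial>\<rho>) \<le> 1 / real n) \<and>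
    (1 - 2 / real n) / 3 \<le> (\<integral>t. H t \<partial>\<rho>)" for n \<rho>
  have "\<exists>\<rho>. stage (Suc n) \<rho>" for n
    by (rule finite_stage[OF zero_less_Suc[of n]]) (auto simp only: stage_def)
  then obtain \<mu> where \<mu>: "\<And>n. stage (Suc n) (\<mu> n)" by metis
  have dist: "\<And>n. real_distribution (\<mu> n)" and one: "\<And>n. measure (\<mu> n) {-1<..1} = 1"
    and disc: "\<And>n i j. i < Suc n \<Longrightarrow> j < Suc n \<Longrightarrow> cmod (\<integral>t. discrepancy i j t \<partial>\<mu> n) \<le> 1 / real (Suc n)"
    and XP: "\<And>n j. j < Suc n \<Longrightarrow> (\<integral>t. modular P (cmod (X j t)) - H t \<partial>\<mu> n) \<le> 1 / real (Suc n)"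
    and YR: "\<And>n i. i < Suc n \<Longrightarrow> (\<integral>t. modular R (cmod (Y i t)) - H t \<partial>\<mu> n) \<le> 1 / real (Suc n)"
    and Hge: "\<And>n. (1 - 2 / real (Suc n)) / 3 \<le> (\<integral>t. H t \<partial>\<mu> n)"
    using \<mu> unfolding stage_def by blast+
  have "tight \<mu>" unfolding tight_def
    by (intro conjI allI impI exI[of _ "-1"] exI[of _ 1]) (simp_all add: dist one)
  then obtain r \<rho> where r: "strict_mono r" and \<rho>: "real_distribution \<rho>" and conv: "weak_conv_m (\<mu> \<circ> r) \<rho>"
    using tight_imp_convergent_subsubsequence[of \<mu> id] by (auto simp: strict_mono_def)
  have lim: "(\<lambda>n. \<integral>t. f t \<partial>\<mu> (r n)) \<longlonglongrightarrow> (\<integral>t. f t \<partial>\<rho>)"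
    if "continuous_on UNIV f" "\<And>t. norm (f t) \<le> K" for f :: "real \<Rightarrow> 'c::{banach, second_countable_topology}" and K
    using weak_conv_imp_integral_bdd_continuous_conv[of "\<mu> \<circ> r" \<rho> f K] dist \<rho> conv that
    by (simp add: continuous_on_eq_continuous_at)
  have inv: "(\<lambda>n. 1 / real (Suc (r n))) \<longlonglongrightarrow> 0"
    using LIMSEQ_subseq_LIMSEQ[OF LIMSEQ_Suc[OF lim_1_over_n] r] by (simp add: o_def)
  have ev: "\<forall>\<^sub>F n in sequentially. k < Suc (r n)" for k
    using eventually_ge_at_top[of k] by eventually_elim (use seq_suble[OF r] in \<open>auto simp: less_Suc_eq_le intro: order_trans\<close>)
  have H1: "norm (H t) \<le> 1" for t using H_bounds[of t] by simp
  have intH: "integrable \<rho> H" by (rule integrable_bounded_continuous[OF \<rho> continuous_H H1])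
  have XP1: "norm (modular P (cmod (X j t))) \<le> modular P (radius P j)"
    and YR1: "norm (modular R (cmod (Y j t))) \<le> modular R (radius R j)" for j t
    using modular_X_le modular_Y_le by (simp_all add: modular_nonneg)
  have intX: "integrable \<rho> (\<lambda>t. modular P (cmod (X j t)))" and intY: "integrable \<rho> (\<lambda>t. modular R (cmod (Y j t)))" for j
    by (rule integrable_bounded_continuous[OF \<rho> continuous_modular[OF adm(1) continuous_X] XP1]
        integrable_bounded_continuous[OF \<rho> continuous_modular[OF adm(2) continuous_Y] YR1])+
  show ?thesis
  proof (rule that[OF \<rho>]; (intro allI)?)
    fix i j
    have "(\<lambda>n. cmod (\<integral>t. discrepancy i j t \<partial>\<mu> (r n))) \<longlonglongrightarrow> cmod (\<integral>t. discrepancy i j t \<partial>\<rho>)"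
      by (intro tendsto_norm lim[OF continuous_discrepancy cmod_discrepancy_le])
    moreover have "\<forall>\<^sub>F n in sequentially. cmod (\<integral>t. discrepancy i j t \<partial>\<mu> (r n)) \<le> 1 / real (Suc (r n))"
      using ev[of i] ev[of j] by eventually_elim (rule disc)
    ultimately have "cmod (\<integral>t. discrepancy i j t \<partial>\<rho>) \<le> 0"
      by (intro tendsto_le[OF sequentially_bot inv]) auto
    then show "(\<integral>t. discrepancy i j t \<partial>\<rho>) = 0" by simp
  next
    fix j
    have "(\<lambda>n. \<integral>t. modular P (cmod (X j t)) - H t \<partial>\<mu> (r n)) \<longlonglongrightarrow> (\<integral>t. modular P (cmod (X j t)) - H t \<partial>\<rho>)"
    proof (rule lim)
      show "norm (modular P (cmod (X j t)) - H t) \<le> modular P (radius P j) + 1" for t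
        using XP1[of j t] H1[of t] by (intro order_trans[OF norm_triangle_ineq4] add_mono)
    qed (rule continuous_X_gap)
    moreover have "\<forall>\<^sub>F n in sequentially. (\<integral>t. modular P (cmod (X j t)) - H t \<partial>\<mu> (r n)) \<le> 1 / real (Suc (r n))"
      using ev[of j] by eventually_elim (rule XP)
    ultimately have "(\<integral>t. modular P (cmod (X j t)) - H t \<partial>\<rho>) \<le> 0"
      by (intro tendsto_le[OF sequentially_bot inv]) auto
    then show "(\<integral>t. modular P (cmod (X j t)) \<partial>\<rho>) \<le> (\<integral>t. H t \<partial>\<rho>)" using intH intX by simp
  next
    fix j
    have "(\<lambda>n. \<integral>t. modular R (cmod (Y j t)) - H t \<partial>\<mu> (r n)) \<longlonglongrightarrow> (\<integral>t. modular R (cmod (Y j t)) - H t \<partial>\<rho>)"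
    proof (rule lim)
      show "norm (modular R (cmod (Y j t)) - H t) \<le> modular R (radius R j) + 1" for t
        using YR1[of j t] H1[of t] by (intro order_trans[OF norm_triangle_ineq4] add_mono)
    qed (rule continuous_Y_gap)
    moreover have "\<forall>\<^sub>F n in sequentially. (\<integral>t. modular R (cmod (Y j t)) - H t \<partial>\<mu> (r n)) \<le> 1 / real (Suc (r n))"
      using ev[of j] by eventually_elim (rule YR)
    ultimately have "(\<integral>t. modular R (cmod (Y j t)) - H t \<partial>\<rho>) \<le> 0"
      by (intro tendsto_le[OF sequentially_bot inv]) auto
    then show "(\<integral>t. modular R (cmod (Y j t)) \<partial>\<rho>) \<le> (\<integral>t. H t \<partial>\<rho>)" using intH intY by simp
  next
    have "(\<lambda>n. (1 - 2 * (1 / real (Suc (r n)))) / 3) \<longlonglongrightarrow> (1 - 2 * 0) / 3" by (intro tendsto_intros inv) auto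
    then have "(1 - 2 * 0) / 3 \<le> (\<integral>t. H t \<partial>\<rho>)"
      using Hge by (intro tendsto_le[OF sequentially_bot lim[OF continuous_H H1]]) (auto intro!: always_eventually)
    then show "0 < (\<integral>t. H t \<partial>\<rho>)" by simp
  qed
qed

section \<open>Return from homogeneous coordinates\<close>

lemma continuous_imp_measurable_distribution:
  fixes f :: "real \<Rightarrow> 'b::real_normed_vector"
  assumes "real_distribution \<rho>" "continuous_on UNIV f"
  shows "f \<in> borel_measurable \<rho>"
proof -
  interpret real_distribution \<rho> by fact
  show ?thesis using borel_measurable_continuous_onI[OF assms(2)] by simp
qed

lemma measurable_G: "real_distribution \<rho> \<Longrightarrow> G \<in> borel_measurable \<rho>"
  unfolding G_def[abs_def] using continuous_imp_measurable_distribution[OF _ continuous_H] by simp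

text \<open>Division by G^(1/Q) undoes the homogenisation and the density restores the lost factor:
  G |Z'|^Q = |Z|^Q where G > 0. Where G = 0 the density annihilates the left side, while Z may be
  nonzero; hence an inequality.\<close>

lemma Lp_norm_density_le_1:
  assumes r: "1 \<le> r" and Q: "Q = enn2real r" and \<rho>: "real_distribution \<rho>"
    and Z: "continuous_on UNIV Z" "\<And>t. cmod (Z t) \<le> radius Q j"
    and \<kappa>: "0 < \<kappa>" "(\<integral>t. modular Q (cmod (Z t)) \<partial>\<rho>) \<le> \<kappa>"
  defines "Z' \<equiv> \<lambda>t. Z t * complex_of_real (G t powr (- (1/Q)))"
  shows "Z' \<in> borel_measurable (density \<rho> (\<lambda>t. ennreal (G t / \<kappa>)))"
    and "Lp_norm (density \<rho> (\<lambda>t. ennreal (G t / \<kappa>))) r Z' \<le> 1"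
proof -
  have mZ[measurable]: "Z \<in> borel_measurable \<rho>" and mG[measurable]: "G \<in> borel_measurable \<rho>"
    using continuous_imp_measurable_distribution[OF \<rho> Z(1)] measurable_G[OF \<rho>] by auto
  have mZ'[measurable]: "Z' \<in> borel_measurable \<rho>" unfolding Z'_def by measurable
  then show mM: "Z' \<in> borel_measurable (density \<rho> (\<lambda>t. ennreal (G t / \<kappa>)))" by simp
  show "Lp_norm (density \<rho> (\<lambda>t. ennreal (G t / \<kappa>))) r Z' \<le> 1"
    using r
  proof (cases rule: ennreal_exponent_cases)
    case infinite
    have "cmod (Z' t) \<le> 1" for t
    proof -
      \<comment> \<open>Here 1/Q = 0; the power is 1, or 0 where \<open>G t = 0\<close>. The radius
        is 1.\<close>
      have "cmod (Z' t) = cmod (Z t) * G t powr 0" using infinite Q by (simp add: Z'_def norm_mult)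
      also have "\<dots> \<le> 1 * 1" using Z(2)[of t] infinite Q by (intro mult_mono) (auto simp: radius_def)
      finally show ?thesis by simp
    qed
    then show ?thesis using infinite by (subst Lp_norm_le_1_iff[OF r mM]) simp
  next
    case finite
    have Q1: "1 \<le> Q" using finite Q by simp
    have "(\<integral>\<^sup>+ t. ennreal (cmod (Z' t) powr Q) \<partial>density \<rho> (\<lambda>t. ennreal (G t / \<kappa>)))
        = (\<integral>\<^sup>+ t. ennreal (G t / \<kappa>) * ennreal (cmod (Z' t) powr Q) \<partial>\<rho>)"
      by (subst nn_integral_density) auto
    also have "\<dots> \<le> (\<integral>\<^sup>+ t. ennreal (modular Q (cmod (Z t)) / \<kappa>) \<partial>\<rho>)"
    proof (rule nn_integral_mono)
      fix t
      have "G t / \<kappa> * cmod (Z' t) powr Q \<le> modular Q (cmod (Z t)) / \<kappa>"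
      proof (cases "G t = 0")
        case True
        then show ?thesis using \<kappa> by (simp add: modular_nonneg)
      next
        case False
        then have G: "0 < G t" using G_bounds(1)[of t] by simp
        have "cmod (Z' t) = cmod (Z t) * G t powr (- (1/Q))"
          unfolding Z'_def norm_mult norm_of_real by simp
        then have "cmod (Z' t) powr Q = cmod (Z t) powr Q * G t powr (- 1)"
          using Q1 by (simp add: powr_mult powr_powr)
        then have "cmod (Z' t) powr Q = cmod (Z t) powr Q / G t"
          using G by (simp add: powr_minus_divide)
        then show ?thesis using G Q1 by (simp add: modular_def)
      qed
      then show "ennreal (G t / \<kappa>) * ennreal (cmod (Z' t) powr Q) \<le> ennreal (modular Q (cmod (Z t)) / \<kappa>)"
        using G_bounds(1)[of t] \<kappa>(1) ennreal_leI by (simp add: ennreal_mult[symmetric])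
    qed
    also have "\<dots> = ennreal (\<integral>t. modular Q (cmod (Z t)) / \<kappa> \<partial>\<rho>)"
    proof (rule nn_integral_eq_integral)
      have "integrable \<rho> (\<lambda>t. modular Q (cmod (Z t)))"
      proof (rule integrable_bounded_continuous[OF \<rho>])
        show "continuous_on UNIV (\<lambda>t. modular Q (cmod (Z t)))"
          using Z(1) Q1 by (intro continuous_modular) (auto simp: admissible_def)
        show "norm (modular Q (cmod (Z t))) \<le> modular Q (radius Q j)" for t
          using modular_mono[OF _ norm_ge_zero Z(2)] Q1 by (simp add: modular_nonneg admissible_def)
      qed
      then show "integrable \<rho> (\<lambda>t. modular Q (cmod (Z t)) / \<kappa>)" by simp
    qed (use \<kappa> in \<open>simp add: modular_nonneg\<close>)
    also have "\<dots> \<le> 1" using \<kappa> by simp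
    finally show ?thesis using finite Q by (subst Lp_norm_le_1_iff[OF r mM]) simp
  qed
qed

text \<open>The powers of G from the density and from the two functions combine to
  \<open>G t powr d\<close>, the factor in \<open>discrepancy\<close>. With vanishing mean
  discrepancy only c_ij times the integral of \<open>H\<close> remains, which \<kappa>
  normalises.\<close>

lemma pairing_density:
  assumes \<rho>: "real_distribution \<rho>" and \<kappa>: "\<kappa> = (\<integral>t. H t \<partial>\<rho>)" "0 < \<kappa>"
    and disc: "(\<integral>t. discrepancy i j t \<partial>\<rho>) = 0"
  shows "pairing (density \<rho> (\<lambda>t. ennreal (G t / \<kappa>)))
      (\<lambda>t. complex_of_real C * (X j t * complex_of_real (G t powr (- (1/P)))))
      (\<lambda>t. Y i t * complex_of_real (G t powr (- (1/R)))) = c i j"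
proof -
  have m[measurable]: "X j \<in> borel_measurable \<rho>" "Y i \<in> borel_measurable \<rho>" "G \<in> borel_measurable \<rho>"
    by (rule continuous_imp_measurable_distribution[OF \<rho> continuous_X]
        continuous_imp_measurable_distribution[OF \<rho> continuous_Y] measurable_G[OF \<rho>])+
  have pointwise: "(G t / \<kappa>) *\<^sub>R ((complex_of_real C * (X j t * complex_of_real (G t powr (- (1/P)))))
        * (Y i t * complex_of_real (G t powr (- (1/R)))))
      = complex_of_real (1 / \<kappa>) * (discrepancy i j t + c i j * complex_of_real (H t))" for t
  proof -
    have "G t * G t powr (- (1/P)) * G t powr (- (1/R)) = G t powr d"
    proof (cases "G t = 0")
      case False
      then have "G t * G t powr (- (1/P)) * G t powr (- (1/R)) = G t powr 1 * G t powr (- (1/P)) * G t powr (- (1/R))"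
        using G_bounds(1)[of t] by simp
      also have "\<dots> = G t powr (1 + - (1/P) + - (1/R))" by (simp only: powr_add)
      also have "1 + - (1/P) + - (1/R) = d" using d by simp
      finally show ?thesis .
    qed simp
    then have "complex_of_real (G t powr d) = complex_of_real (G t) * complex_of_real (G t powr (- (1/P))) * complex_of_real (G t powr (- (1/R)))"
      by (metis of_real_mult)
    then show ?thesis unfolding discrepancy_def by (simp add: scaleR_conv_of_real mult_ac)
  qed
  have "pairing (density \<rho> (\<lambda>t. ennreal (G t / \<kappa>)))
      (\<lambda>t. complex_of_real C * (X j t * complex_of_real (G t powr (- (1/P)))))
      (\<lambda>t. Y i t * complex_of_real (G t powr (- (1/R))))
    = (\<integral>t. complex_of_real (1 / \<kappa>) * (discrepancy i j t + c i j * complex_of_real (H t)) \<partial>\<rho>)"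
    unfolding pairing_def pointwise[symmetric] using G_bounds(1) \<kappa>(2)
    by (intro integral_density) (auto intro!: AE_I2)
  also have "\<dots> = complex_of_real (1 / \<kappa>) * ((\<integral>t. discrepancy i j t \<partial>\<rho>) + c i j * complex_of_real (\<integral>t. H t \<partial>\<rho>))"
  proof -
    have H1: "norm (H t) \<le> 1" for t using H_bounds[of t] by simp
    have "integrable \<rho> (discrepancy i j)" "integrable \<rho> H"
      by (rule integrable_bounded_continuous[OF \<rho> continuous_discrepancy cmod_discrepancy_le]
        integrable_bounded_continuous[OF \<rho> continuous_H H1])+
    then show ?thesis by (simp add: integral_complex_of_real)
  qed
  also have "\<dots> = c i j" using disc \<kappa> by simp
  finally show ?thesis .
qed

end

lemma Lp_norm_cmult_le:
  assumes p: "1 \<le> p" and f: "f \<in> borel_measurable M" "Lp_norm M p f \<le> 1" and C: "0 \<le> (C::real)"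
  shows "Lp_norm M p (\<lambda>w. complex_of_real C * f w) \<le> ennreal C"
proof (cases "C = 0")
  case True
  have "esssup M (\<lambda>w. 0 :: ennreal) \<le> 0" by (intro esssup_I) auto
  then have "Lp_norm M p (\<lambda>w. 0) \<le> 0"
    by (auto simp: Lp_norm_def)
  then show ?thesis using True by simp
next
  case False
  have "Lp_norm M p (\<lambda>w. complex_of_real C * f w) \<le> ennreal (cmod (complex_of_real C)) * Lp_norm M p f"
    using False by (intro Lp_norm_scale_le p f) simp
  also have "\<dots> \<le> ennreal C * 1" using f C by (intro mult_mono) auto
  finally show ?thesis by simp
qed

lemma multiplier_bound_imp_factorization:
  assumes q: "1 \<le> q" and qp: "q \<le> p" and C: "0 \<le> C"
    and c: "multiplier_bound (enn2real p) (enn2real (conj_exponent q)) c C"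
  shows "\<exists>M :: real measure. factorization_on M p q c C"
proof -
  define r where "r = conj_exponent q"
  define P where "P = enn2real p"
  define R where "R = enn2real r"
  define d where "d = 1 - 1/P - 1/R"
  have p: "1 \<le> p" and r: "1 \<le> r" using q qp one_le_conj_exponent by (auto simp: r_def)
  have d0: "0 \<le> d" "d = 0 \<longleftrightarrow> p = q" using exponent_gap[OF q qp] by (auto simp: d_def P_def R_def r_def)
  interpret bounded_multiplier P R d C c
    using p r d0 C c by unfold_locales (auto simp: P_def R_def r_def d_def intro: admissible_enn2real)
  obtain \<rho> where \<rho>: "real_distribution \<rho>" and disc: "\<forall>i j. (\<integral>t. discrepancy i j t \<partial>\<rho>) = 0"
    and XP: "\<forall>j. (\<integral>t. modular P (cmod (X j t)) \<partial>\<rho>) \<le> (\<integral>t. H t \<partial>\<rho>)"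
    and YR: "\<forall>i. (\<integral>t. modular R (cmod (Y i t)) \<partial>\<rho>) \<le> (\<integral>t. H t \<partial>\<rho>)"
    and pos: "0 < (\<integral>t. H t \<partial>\<rho>)"
    using limit_measure by blast
  define \<kappa> where "\<kappa> = (\<integral>t. H t \<partial>\<rho>)"
  define M where "M = density \<rho> (\<lambda>t. ennreal (G t / \<kappa>))"
  define x where "x j t = X j t * complex_of_real (G t powr (- (1/P)))" for j t
  define y where "y i t = Y i t * complex_of_real (G t powr (- (1/R)))" for i t
  have \<kappa>: "0 < \<kappa>" using pos by (simp add: \<kappa>_def)
  have x: "x j \<in> borel_measurable M" "Lp_norm M p (x j) \<le> 1" for j
    using Lp_norm_density_le_1[OF p P_def \<rho> continuous_X cmod_X_le \<kappa> XP[rule_format, folded \<kappa>_def]]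
    unfolding M_def x_def[abs_def] by auto
  have y: "y i \<in> borel_measurable M" "Lp_norm M r (y i) \<le> 1" for i
    using Lp_norm_density_le_1[OF r R_def \<rho> continuous_Y cmod_Y_le \<kappa> YR[rule_format, folded \<kappa>_def]]
    unfolding M_def y_def[abs_def] by auto
  \<comment> \<open>The constant C goes entirely into the first family; the second has norms at most
    1.\<close>
  define z where "z j t = complex_of_real C * x j t" for j t
  have z: "z j \<in> borel_measurable M" "Lp_norm M p (z j) \<le> ennreal C" for j
    using x[of j] Lp_norm_cmult_le[OF p x C] unfolding z_def[abs_def] by auto
  have SUPz: "(SUP j. Lp_norm M p (z j)) \<le> ennreal C" by (intro SUP_least z)
  have SUPy: "(SUP i. Lp_norm M r (y i)) \<le> 1" by (intro SUP_least y)
  have "prob_space M" if "p \<noteq> q"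
  proof (rule prob_spaceI)
    interpret \<rho>: real_distribution \<rho> by fact
    \<comment> \<open>For \<open>p \<noteq> q\<close> the density is H/\<kappa>, of total mass 1;
      for p = q it is the constant 1/\<kappa>.\<close>
    have G: "G = H" using that d0 by (auto simp: G_def)
    have H1: "norm (H t) \<le> 1" for t using H_bounds[of t] by simp
    have int: "integrable \<rho> H" by (rule integrable_bounded_continuous[OF \<rho> continuous_H H1])
    have "emeasure M (space M) = (\<integral>\<^sup>+ t. ennreal (H t / \<kappa>) \<partial>\<rho>)"
      using int unfolding M_def G by (simp add: emeasure_density)
    also have "\<dots> = ennreal (\<integral>t. H t / \<kappa> \<partial>\<rho>)"
      using int \<kappa> H_bounds by (intro nn_integral_eq_integral) auto
    also have "\<dots> = 1" using \<kappa> by (simp add: \<kappa>_def[symmetric])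
    finally show "emeasure M (space M) = 1" .
  qed
  moreover have "pairing M (z j) (y i) = c i j" for i j
    unfolding M_def z_def[abs_def] x_def[abs_def] y_def[abs_def]
    by (rule pairing_density[OF \<rho> \<kappa>_def \<kappa> disc[rule_format]])
  moreover have "z j \<in> Lp_space M p" "y j \<in> Lp_space M r" for j
    using z[of j] y[of j] by (auto simp: Lp_space_def intro: le_less_trans)
  moreover have "(SUP j. Lp_norm M p (z j)) < \<infinity>" "(SUP i. Lp_norm M r (y i)) < \<infinity>"
    using SUPz SUPy by (auto intro: le_less_trans)
  moreover have "(SUP i. Lp_norm M r (y i)) * (SUP j. Lp_norm M p (z j)) \<le> ennreal C"
    using mult_mono[OF SUPy SUPz] by simp
  ultimately have "factorization_on M p q c C"
    unfolding factorization_on_def r_def[symmetric] by (intro conjI impI exI[of _ z] exI[of _ y]) auto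
  then show ?thesis by blast
qed

theorem corollary4p5:
  fixes c :: "nat \<Rightarrow> nat \<Rightarrow> complex" and C :: real and p q :: ennreal
  assumes "0 \<le> C" and "1 \<le> q" and "q \<le> p"
  shows "((schur_multiplier p q c \<and> schur_norm p q c \<le> ennreal C)
            \<longleftrightarrow> (\<exists>M :: real measure. factorization_on M p q c C))
       \<and> ((\<exists>M :: 'w measure. factorization_on M p q c C)
            \<longrightarrow> schur_multiplier p q c \<and> schur_norm p q c \<le> ennreal C)"
proof -
  have p: "1 \<le> p" using assms by auto
  have "\<exists>M :: real measure. factorization_on M p q c C"
    if "schur_multiplier p q c" "schur_norm p q c \<le> ennreal C"
    using multiplier_bound_imp_factorization[OF assms(2,3,1) schur_imp_multiplier_bound[OF p assms(2,1) that]] .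
  then show ?thesis
    using factorization_on_imp_schur[OF assms(2,3,1), where M = "M :: real measure" for M]
      factorization_on_imp_schur[OF assms(2,3,1), where M = "M :: 'w measure" for M] by blast
qed

end
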